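(* Let $\Omega$ be a bounded $\mathscr{C}^{1,1}$ domain in $\mathbb{R}^d$. Then there exists an optimal admissible mesh for $K:=\overline{\Omega}$.
   Context: Notation: $\mathscr{P}^n(\mathbb{R}^d)$ is the space of real polynomials in $d$ real variables of total degree at most $n$; $\|f\|_X:=\sup_{x\in X}|f(x)|$. Admissible meshes: let $K\subset\mathbb{R}^d$ be compact and polynomial determining (any polynomial vanishing on $K$ is the null polynomial). An admissible mesh for $K$ is a sequence $\{A_n\}_{n}$ of finite subsets of $K$ such that $\operatorname{Card}(A_n)$ grows at most polynomially in $n$ and there is a constant $C>0$, independent of $n$, with $\|p\|_K\le C\|p\|_{A_n}$ for all $p\in\mathscr{P}^n(\mathbb{R}^d)$ and all $n$. It is called optimal if $\operatorname{Card}(A_n)=O(n^d)$. $\mathscr{C}^{1,1}$ domain: a domain $\Omega\subset\mathbb{R}^d$ is a $\mathscr{C}^{1,1}$ domain iff there exist $r>0$, $L>0$ such that for every $x\in\partial\Omega$ there exist a rotation $R_x\in SO_d$ and a function $f_x\in\mathscr{C}^{1,1}(B^{d-1}(0,r),\,]-r,r[)$ (differentiable with Lipschitz gradient), where $B^{d-1}(0,r)$ is the ball of radius $r$ centered at $0$ in $\mathbb{R}^{d-1}$, such that $f_x(0)=0$, $\nabla f_x(0)=0$, $\|f_x\|_{\mathscr{C}^{1,1}}\le L$ and $$x+R_x\operatorname{Graph}(f_x)=\partial\Omega\cap\left(x+R_x\left(B^{d-1}(0,r)\times]-r,r[\right)\right),$$ where $\|f\|_{\mathscr{C}^{1,1}}:=\max\{\sup|f|,\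 \sup|\nabla f|,\ \operatorname{Lip}(\nabla f)\}$ on the domain of $f$. *)

theory Defs
  imports "HOL-Analysis.Analysis" "HOL-Library.Landau_Symbols"
begin

text \<open>
  The Euclidean space of dimension \<open>d\<close> is \<^typ>\<open>real ^ 'n\<close> with \<open>d = CARD('n)\<close>.
\<close>

definition monomial :: "('n::finite \<Rightarrow> nat) \<Rightarrow> real ^ 'n \<Rightarrow> real" where
  "monomial \<alpha> x = (\<Prod>i\<in>UNIV. (x $ i) ^ \<alpha> i)"

definition multi_indices :: "nat \<Rightarrow> ('n::finite \<Rightarrow> nat) set" where
  "multi_indices n = {\<alpha>. (\<Sum>i\<in>UNIV. \<alpha> i) \<le> n}"

lemma finite_multi_indices: "finite (multi_indices n :: ('n::finite \<Rightarrow> nat) set)"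
proof (rule finite_subset)
  show "(multi_indices n :: ('n \<Rightarrow> nat) set) \<subseteq> Pi\<^sub>E UNIV (\<lambda>_. {..n})"
  proof
    fix \<alpha> :: "'n \<Rightarrow> nat"
    assume "\<alpha> \<in> multi_indices n"
    then have "(\<Sum>i\<in>UNIV. \<alpha> i) \<le> n"
      by (simp add: multi_indices_def)
    moreover have "\<alpha> j \<le> (\<Sum>i\<in>UNIV. \<alpha> i)" for j
      by (rule member_le_sum) auto
    ultimately show "\<alpha> \<in> Pi\<^sub>E UNIV (\<lambda>_. {..n})"
      by (force intro: order_trans)
  qed
qed (simp add: finite_PiE)

text \<open>
  Real polynomials are identified with the functions they induce, which is
  harmless over an infinite field.
\<close>

definition poly_space :: "nat \<Rightarrow> (real ^ 'n \<Rightarrow> real) set" where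
  "poly_space n = {\<lambda>x. \<Sum>\<alpha>\<in>multi_indices n. c \<alpha> * monomial \<alpha> x | c. True}"

definition polynomial_determining :: "(real ^ 'n) set \<Rightarrow> bool" where
  "polynomial_determining K \<longleftrightarrow>
     (\<forall>n. \<forall>p\<in>poly_space n. (\<forall>x\<in>K. p x = 0) \<longrightarrow> p = (\<lambda>x. 0))"

text \<open>
  The supremum is that of the reals, hence meaningful for bounded functions on
  nonempty sets. In the mesh inequality below this is automatic: a polynomial
  determining set is nonempty, and an empty \<open>A n\<close> would make the right-hand side
  independent of \<open>p\<close>, which large constants \<open>p\<close> rule out.
\<close>

definition sup_norm_on :: "'a set \<Rightarrow> ('a \<Rightarrow> real) \<Rightarrow> real" where
  "sup_norm_on X f = (SUP x\<in>X. \<bar>f x\<bar>)"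

definition admissible_mesh :: "(real ^ 'n) set \<Rightarrow> (nat \<Rightarrow> (real ^ 'n) set) \<Rightarrow> bool" where
  "admissible_mesh K A \<longleftrightarrow>
     compact K \<and> polynomial_determining K \<and>
     (\<forall>n. finite (A n) \<and> A n \<subseteq> K) \<and>
     (\<exists>s. (\<lambda>n. real (card (A n))) \<in> O(\<lambda>n. real n ^ s)) \<and>
     (\<exists>C>0. \<forall>n. \<forall>p\<in>poly_space n. sup_norm_on K p \<le> C * sup_norm_on (A n) p)"

definition optimal_admissible_mesh :: "(real ^ 'n) set \<Rightarrow> (nat \<Rightarrow> (real ^ 'n) set) \<Rightarrow> bool" where
  "optimal_admissible_mesh K A \<longleftrightarrow>
     admissible_mesh K A \<and> (\<lambda>n. real (card (A n))) \<in> O(\<lambda>n. real n ^ CARD('n))"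

text \<open>
  The space of dimension \<open>d - 1\<close> is realised as the hyperplane on which the \<open>k\<close>-th
  coordinate vanishes, where the index \<open>k\<close> plays the role of the last coordinate; this
  includes \<open>d = 1\<close>, for which the hyperplane is a point.
  The pair \<open>(y, t)\<close> of a hyperplane point and a real number is the vector
  \<open>y + axis k t\<close>.
\<close>

definition coord_hyperplane :: "'n \<Rightarrow> (real ^ 'n) set" where
  "coord_hyperplane k = {y. y $ k = 0}"

definition hyperplane_ball :: "'n::finite \<Rightarrow> real \<Rightarrow> (real ^ 'n) set" where
  "hyperplane_ball k r = ball 0 r \<inter> coord_hyperplane k"

definition cylinder :: "'n::finite \<Rightarrow> real \<Rightarrow> (real ^ 'n) set" where
  "cylinder k r = (\<lambda>(y, t). y + axis k t) ` (hyperplane_ball k r \<times> {-r<..<r})"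

definition graph_over :: "'n::finite \<Rightarrow> real \<Rightarrow> (real ^ 'n \<Rightarrow> real) \<Rightarrow> (real ^ 'n) set" where
  "graph_over k r f = (\<lambda>y. y + axis k (f y)) ` hyperplane_ball k r"

text \<open>
  Gradient of a function of \<open>d - 1\<close> variables; requiring it to lie in the hyperplane makes
  it unique. Only the values of \<open>f\<close> on the hyperplane near \<open>y\<close> matter.
\<close>

definition hyperplane_grad :: "'n::finite \<Rightarrow> (real ^ 'n \<Rightarrow> real) \<Rightarrow> real ^ 'n \<Rightarrow> real ^ 'n" where
  "hyperplane_grad k f y =
     (THE v. v \<in> coord_hyperplane k \<and>
             (f has_derivative (\<lambda>h. v \<bullet> h)) (at y within coord_hyperplane k))"

definition C11_on_ball :: "'n::finite \<Rightarrow> real \<Rightarrow> (real ^ 'n \<Rightarrow> real) \<Rightarrow> bool" where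
  "C11_on_ball k r f \<longleftrightarrow>
     (\<forall>y\<in>hyperplane_ball k r. f differentiable (at y within coord_hyperplane k)) \<and>
     (\<exists>M. M-lipschitz_on (hyperplane_ball k r) (hyperplane_grad k f))"

text \<open>
  The value lies in \<^typ>\<open>ennreal\<close> because membership in the class does not bound
  \<open>f\<close> by itself. In the last supremum the diagonal pairs contribute \<open>0 / 0 = 0\<close>.
\<close>

definition C11_norm :: "'n::finite \<Rightarrow> real \<Rightarrow> (real ^ 'n \<Rightarrow> real) \<Rightarrow> ennreal" where
  "C11_norm k r f =
     Max {SUP y\<in>hyperplane_ball k r. ennreal \<bar>f y\<bar>,
          SUP y\<in>hyperplane_ball k r. ennreal (norm (hyperplane_grad k f y)),
          SUP (y, z)\<in>hyperplane_ball k r \<times> hyperplane_ball k r.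
            ennreal (dist (hyperplane_grad k f y) (hyperplane_grad k f z) / dist y z)}"

definition C11_domain :: "'n::finite \<Rightarrow> (real ^ 'n) set \<Rightarrow> bool" where
  "C11_domain k \<Omega> \<longleftrightarrow>
     open \<Omega> \<and> connected \<Omega> \<and> \<Omega> \<noteq> {} \<and>
     (\<exists>r>0. \<exists>L>0. \<forall>x\<in>frontier \<Omega>. \<exists>R f.
        rotation_matrix R \<and>
        C11_on_ball k r f \<and> f ` hyperplane_ball k r \<subseteq> {-r<..<r} \<and>
        f 0 = 0 \<and> hyperplane_grad k f 0 = 0 \<and> C11_norm k r f \<le> ennreal L \<and>
        (\<lambda>z. x + R *v z) ` graph_over k r f =
          frontier \<Omega> \<inter> (\<lambda>z. x + R *v z) ` cylinder k r)"

end

theory Submission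
  imports Defs "HOL-Complex_Analysis.Complex_Analysis"
begin

text \<open>
  By Bernstein's inequality, a polynomial of degree \<open>n\<close> that is bounded by \<open>M\<close> on a complete ellipse
  \<open>c + cos t *\<^sub>R u + sin t *\<^sub>R v\<close> is Lipschitz in the angle \<open>t\<close> with constant \<open>3 * n * M\<close>
  (\<open>bernstein_ellipse\<close>). Hence if two points of \<open>K = closure \<Omega>\<close> are joined by an arc of angle \<open>\<eta> / n\<close> of an
  ellipse contained in \<open>K\<close>, the values of the polynomial differ by at most \<open>3 * \<eta>\<close> times its supremum
  on \<open>K\<close>. If every point of \<open>K\<close> is joined in this way, through a bounded number of arcs, to a point of a
  finite set \<open>A\<close>, and \<open>\<eta>\<close> is small, then \<open>\<bar>p x\<bar>\<close> exceeds the supremum over \<open>A\<close> by at most half the supremum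
  over \<open>K\<close>, and so the supremum over \<open>K\<close> is at most twice that over \<open>A\<close>. Such sets can be united over
  finitely many pieces of \<open>K\<close>, so that by compactness it suffices to construct them near each point of
  \<open>K\<close> (\<open>meshable_in_if_locally\<close>), with \<open>O(n ^ d)\<close> points.

  Near an interior point a net of mesh width \<open>\<eta> / n\<close> does (\<open>meshable_in_interior\<close>). Near a boundary
  point, \<open>K\<close> is, on each side of the boundary where it has points, the region above the graph of a
  \<open>C11\<close> function \<open>f\<close> on a hyperplane. There a point is described by its foot point \<open>y\<close> in the hyperplane
  and its height \<open>s\<close> above the graph, and there are two kinds of ellipses. Segments orthogonal to the
  hyperplane are degenerate ellipses; they change \<open>s\<close> at a cost proportional to the change of \<open>sqrt s\<close>
  (\<open>bernstein_segment_end\<close>). To change \<open>y\<close>, one uses an ellipse that starts parallel to the tangent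
  plane of the graph and bends away from it. It stays above the graph because the second-order error of \<open>f\<close>, which is at most quadratic
  by the Lipschitz condition on the gradient, is dominated by the bending term (\<open>bernstein_tangential\<close>).
  The bending raises the height by \<open>O(\<tau>\<^sup>2)\<close> over a distance \<open>\<tau>\<close>, which changes \<open>sqrt s\<close> by \<open>O(\<tau>)\<close> only, and
  this is repaired by a move of the first kind. So polynomials of degree \<open>n\<close> are Lipschitz with
  constant \<open>O(n)\<close> in the \<open>d\<close> coordinates \<open>(y, sqrt s)\<close>, uniformly up to the boundary, and a net of width
  \<open>\<eta> / n\<close> in these coordinates yields the mesh (\<open>meshable_in_above_graph\<close>); in the domain itself its
  points accumulate at the boundary like Chebyshev points.
\<close>

section \<open>Bernstein's inequality for trigonometric polynomials\<close>

lemma poly_bound_unit_disc: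
  fixes Q :: "complex poly"
  assumes "\<And>z. norm z = 1 \<Longrightarrow> norm (poly Q z) \<le> M" and "norm z \<le> 1"
  shows "norm (poly Q z) \<le> M"
proof (rule maximum_modulus_frontier[where S = "cball 0 1" and f = "poly Q"])
  show "poly Q holomorphic_on interior (cball 0 1)"
    by (intro holomorphic_intros)
qed (use assms in \<open>auto intro!: continuous_intros\<close>)

text \<open>
  The reversed polynomial \<open>w \<mapsto> w ^ degree Q * poly Q (1 / w)\<close> has the same modulus as \<open>Q\<close> on the unit
  circle, so the maximum principle in the disc transfers to the outside of the disc, at the price of
  the growth factor.
\<close>

lemma poly_bound_outside_unit_disc:
  fixes Q :: "complex poly"
  assumes M: "\<And>z. norm z = 1 \<Longrightarrow> norm (poly Q z) \<le> M"
    and deg: "degree Q \<le> m" and z: "1 \<le> norm z"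
  shows "norm (poly Q z) \<le> M * norm z ^ m"
proof -
  have M0: "0 \<le> M"
    using order_trans[OF norm_ge_zero M[of 1]] by simp
  have refl: "norm (poly (reflect_poly Q) w) \<le> M" if w: "norm w = 1" for w
  proof -
    have "w \<noteq> 0"
      using w by auto
    then have "norm (poly (reflect_poly Q) w) = norm (poly Q (inverse w))"
      using w by (simp add: poly_reflect_poly_nz norm_mult norm_power)
    also have "\<dots> \<le> M"
      using w by (intro M) (simp add: norm_inverse)
    finally show ?thesis .
  qed
  have nz: "z \<noteq> 0"
    using z by auto
  have "norm (poly (reflect_poly Q) (inverse z)) \<le> M"
    using refl by (rule poly_bound_unit_disc) (use z in \<open>auto simp: norm_inverse inverse_le_1_iff\<close>)
  then have "norm (poly Q z) / norm z ^ degree Q \<le> M"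
    using nz by (simp add: poly_reflect_poly_nz norm_mult norm_power norm_inverse norm_divide field_simps)
  then have "norm (poly Q z) \<le> M * norm z ^ degree Q"
    using nz by (simp add: field_simps)
  also have "\<dots> \<le> M * norm z ^ m"
    using M0 z deg by (intro mult_left_mono power_increasing)
  finally show ?thesis .
qed

text \<open>
  A real trigonometric polynomial of degree \<open>n\<close> has the form \<open>exp (- \<i> n w) * poly Q (exp (\<i> w))\<close> with
  \<open>degree Q \<le> 2 * n\<close>. In the upper half-plane \<open>exp (\<i> w)\<close> lies in the disc and only the first factor
  grows; in the lower half-plane \<open>Q\<close> grows like \<open>exp (- 2 * n * Im w)\<close>, and the first factor takes
  back half of the exponent.
\<close>

lemma trig_poly_strip_bound:
  fixes Q :: "complex poly"
  assumes M: "\<And>z. norm z = 1 \<Longrightarrow> norm (poly Q z) \<le> M" and deg: "degree Q \<le> 2 * n"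
  shows "norm (exp (- (\<i> * of_nat n * w)) * poly Q (exp (\<i> * w))) \<le> M * exp (real n * \<bar>Im w\<bar>)"
proof -
  have eq: "norm (exp (- (\<i> * of_nat n * w))) = exp (real n * Im w)"
    by (simp add: norm_exp_eq_Re)
  have ez: "norm (exp (\<i> * w)) = exp (- Im w)"
    by (simp add: norm_exp_eq_Re)
  show ?thesis
  proof (cases "Im w \<ge> 0")
    case True
    have "norm (poly Q (exp (\<i> * w))) \<le> M"
      by (rule poly_bound_unit_disc[OF M]) (simp_all add: ez True)
    then show ?thesis
      using mult_left_mono[of _ M "exp (real n * Im w)"] True by (simp add: norm_mult eq mult.commute)
  next
    case False
    then have "norm (poly Q (exp (\<i> * w))) \<le> M * exp (- Im w) ^ (2 * n)"
      using poly_bound_outside_unit_disc[OF M deg, of "exp (\<i> * w)"] by (simp add: ez)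
    moreover have "exp (- Im w) ^ (2 * n) = exp (- 2 * real n * Im w)"
      by (subst exp_of_nat_mult[symmetric]) simp
    ultimately have "norm (poly Q (exp (\<i> * w))) \<le> M * exp (- 2 * real n * Im w)"
      by simp
    then have "exp (real n * Im w) * norm (poly Q (exp (\<i> * w)))
        \<le> exp (real n * Im w) * (M * exp (- 2 * real n * Im w))"
      by (intro mult_left_mono) auto
    also have "\<dots> = M * (exp (real n * Im w) * exp (- 2 * real n * Im w))"
      by (simp only: mult_ac)
    also have "\<dots> = M * exp (real n * \<bar>Im w\<bar>)"
      unfolding exp_add[symmetric] using False by (simp add: abs_if)
    finally show ?thesis
      by (simp add: norm_mult eq)
  qed
qed

text \<open>
  Bernstein's inequality with the constant \<open>3\<close> in place of the sharp \<open>1\<close>: in a disc of radius \<open>1 / n\<close>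
  around a real point the strip bound costs only the factor \<open>exp 1 \<le> 3\<close>, and Cauchy's inequality
  in this disc bounds the derivative by \<open>3 * n * M\<close>.
\<close>

lemma trig_poly_lipschitz:
  fixes Q :: "complex poly" and s t :: real
  assumes M: "\<And>z. norm z = 1 \<Longrightarrow> norm (poly Q z) \<le> M" and deg: "degree Q \<le> 2 * n" and n: "0 < n"
  defines "g \<equiv> \<lambda>w. exp (- (\<i> * of_nat n * w)) * poly Q (exp (\<i> * w))"
  shows "norm (g (of_real t) - g (of_real s)) \<le> 3 * real n * M * \<bar>t - s\<bar>"
proof -
  have M0: "0 \<le> M"
    using order_trans[OF norm_ge_zero M[of 1]] by simp
  have holo: "g holomorphic_on A" for A
    unfolding g_def by (intro holomorphic_intros)
  have bound: "norm (deriv g w) \<le> 3 * real n * M" if w: "w \<in> \<real>" for w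
  proof -
    have "norm ((deriv ^^ 1) g w) \<le> fact 1 * (3 * M) / (1 / real n) ^ 1"
    proof (rule Cauchy_inequality)
      show "continuous_on (cball w (1 / real n)) g"
        using holo by (rule holomorphic_on_imp_continuous_on)
      fix x assume x: "norm (w - x) = 1 / real n"
      have "\<bar>Im x\<bar> \<le> 1 / real n"
        using abs_Im_le_cmod[of "w - x"] w x by (simp add: complex_is_Real_iff)
      then have "real n * \<bar>Im x\<bar> \<le> 1"
        using n by (simp add: field_simps)
      then have "exp (real n * \<bar>Im x\<bar>) \<le> exp 1"
        by simp
      then have "exp (real n * \<bar>Im x\<bar>) \<le> 3"
        using exp_le by linarith
      then have "M * exp (real n * \<bar>Im x\<bar>) \<le> M * 3"
        using M0 by (intro mult_left_mono)
      then show "norm (g x) \<le> 3 * M"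
        using trig_poly_strip_bound[OF M deg, of x] by (simp add: g_def)
    qed (use holo n in auto)
    then show ?thesis
      by (simp add: field_simps)
  qed
  have "norm (g (of_real t) - g (of_real s)) \<le> 3 * real n * M * norm (of_real t - of_real s :: complex)"
  proof (rule field_differentiable_bound[where S = \<real> and f' = "deriv g"])
    show "(g has_field_derivative deriv g z) (at z within \<real>)" for z
      using holomorphic_derivI[OF holo[of UNIV], of z \<real>] by simp
  qed (auto simp: bound convex_Reals)
  then show ?thesis
    by (simp flip: of_real_diff)
qed

section \<open>Polynomials in several variables on ellipses\<close>

lemma poly_space_cases:
  assumes "p \<in> poly_space n"
  obtains c where "p = (\<lambda>x. \<Sum>\<alpha>\<in>multi_indices n. c \<alpha> * monomial \<alpha> x)"
  using assms by (auto simp: poly_space_def)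

lemma poly_space_mono:
  assumes "m \<le> n" shows "(poly_space m :: (real ^ 'n \<Rightarrow> real) set) \<subseteq> poly_space n"
proof
  fix p :: "real ^ 'n \<Rightarrow> real" assume "p \<in> poly_space m"
  then obtain c where p: "p = (\<lambda>x. \<Sum>\<alpha>\<in>multi_indices m. c \<alpha> * monomial \<alpha> x)"
    by (rule poly_space_cases)
  have sub: "(multi_indices m :: ('n \<Rightarrow> nat) set) \<subseteq> multi_indices n"
    using assms by (auto simp: multi_indices_def)
  show "p \<in> poly_space n"
    unfolding p poly_space_def using sub
    by (intro CollectI exI[of _ "\<lambda>\<alpha>. if \<alpha> \<in> multi_indices m then c \<alpha> else 0"] conjI ext
        sum.mono_neutral_cong_left finite_multi_indices TrueI) auto
qed

lemma continuous_on_poly_space: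
  assumes "p \<in> poly_space n" shows "continuous_on S p"
proof -
  obtain c where p: "p = (\<lambda>x. \<Sum>\<alpha>\<in>multi_indices n. c \<alpha> * monomial \<alpha> x)"
    using assms by (rule poly_space_cases)
  show ?thesis
    unfolding p monomial_def by (intro continuous_intros)
qed

text \<open>
  With \<open>z = exp (\<i> t)\<close>, each coordinate of a point of the ellipse is \<open>1 / z\<close> times a quadratic
  polynomial in \<open>z\<close>, so a monomial of degree \<open>m \<le> n\<close> becomes \<open>z ^ (- n)\<close> times a polynomial of degree
  \<open>(n - m) + 2 * m \<le> 2 * n\<close>.
\<close>

lemma poly_space_on_ellipse:
  fixes c u v :: "real ^ 'n"
  assumes "p \<in> poly_space n"
  obtains Q :: "complex poly" where "degree Q \<le> 2 * n"
    and "\<forall>t. complex_of_real (p (c + cos t *\<^sub>R u + sin t *\<^sub>R v)) =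
           exp (- (\<i> * of_nat n * of_real t)) * poly Q (exp (\<i> * of_real t))"
proof -
  obtain b where p: "p = (\<lambda>x. \<Sum>\<alpha>\<in>multi_indices n. b \<alpha> * monomial \<alpha> x)"
    using assms by (rule poly_space_cases)
  define q :: "'n \<Rightarrow> complex poly" where
    "q i = [:(of_real (u $ i) + \<i> * of_real (v $ i)) / 2, of_real (c $ i),
             (of_real (u $ i) - \<i> * of_real (v $ i)) / 2:]" for i
  define Q where "Q = (\<Sum>\<alpha>\<in>multi_indices n.
      smult (of_real (b \<alpha>)) (monom 1 (n - (\<Sum>i\<in>UNIV. \<alpha> i)) * (\<Prod>i\<in>UNIV. q i ^ \<alpha> i)))"
  have "degree (q i) \<le> 2" for i
    by (auto simp: q_def)
  then have qpow: "degree (q i ^ m) \<le> 2 * m" for i m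
    using degree_power_le[of "q i" m] by (meson mult_le_mono1 order_trans)
  have "degree (smult (of_real (b \<alpha>)) (monom 1 (n - (\<Sum>i\<in>UNIV. \<alpha> i)) * (\<Prod>i\<in>UNIV. q i ^ \<alpha> i))) \<le> 2 * n"
    if "\<alpha> \<in> multi_indices n" for \<alpha>
  proof -
    have le: "(\<Sum>i\<in>UNIV. \<alpha> i) \<le> n"
      using that by (simp add: multi_indices_def)
    have "degree (\<Prod>i\<in>UNIV. q i ^ \<alpha> i) \<le> (\<Sum>i\<in>UNIV. degree (q i ^ \<alpha> i))"
      using degree_prod_sum_le[of UNIV "\<lambda>i. q i ^ \<alpha> i"] by (simp add: o_def)
    also have "\<dots> \<le> (\<Sum>i\<in>UNIV. 2 * \<alpha> i)"
      by (intro sum_mono qpow)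
    finally have 1: "degree (\<Prod>i\<in>UNIV. q i ^ \<alpha> i) \<le> 2 * (\<Sum>i\<in>UNIV. \<alpha> i)"
      by (simp add: sum_distrib_left)
    have "degree (monom (1::complex) (n - (\<Sum>i\<in>UNIV. \<alpha> i)) * (\<Prod>i\<in>UNIV. q i ^ \<alpha> i)) \<le> 2 * n"
      using degree_mult_le[of "monom (1::complex) (n - (\<Sum>i\<in>UNIV. \<alpha> i))" "\<Prod>i\<in>UNIV. q i ^ \<alpha> i"]
        degree_monom_le[of "1::complex" "n - (\<Sum>i\<in>UNIV. \<alpha> i)"] 1 le by linarith
    then show ?thesis
      using degree_smult_le order_trans by blast
  qed
  then have deg_Q: "degree Q \<le> 2 * n"
    unfolding Q_def by (intro degree_sum_le finite_multi_indices)
  have eq_Q: "complex_of_real (p (c + cos t *\<^sub>R u + sin t *\<^sub>R v)) =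
      exp (- (\<i> * of_nat n * of_real t)) * poly Q (exp (\<i> * of_real t))" for t
  proof -
    define z where "z = exp (\<i> * of_real t)"
    have z0: "z \<noteq> 0"
      by (simp add: z_def)
    have zn: "exp (- (\<i> * of_nat n * of_real t)) = inverse (z ^ n)"
      unfolding z_def by (simp add: exp_of_nat_mult[symmetric] exp_minus mult_ac)
    have cos: "complex_of_real (cos t) = (z + inverse z) / 2"
      by (simp add: z_def cos_of_real[symmetric] cos_exp_eq exp_minus)
    have sin: "complex_of_real (sin t) = - \<i> * (z - inverse z) / 2"
      by (simp add: z_def sin_of_real[symmetric] sin_exp_eq exp_minus field_simps)
    have coord: "z * complex_of_real ((c + cos t *\<^sub>R u + sin t *\<^sub>R v) $ i) = poly (q i) z" for i
      using z0 by (simp add: q_def cos sin field_simps power2_eq_square)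
    have "complex_of_real (monomial \<alpha> (c + cos t *\<^sub>R u + sin t *\<^sub>R v)) * z ^ n =
        z ^ (n - (\<Sum>i\<in>UNIV. \<alpha> i)) * (\<Prod>i\<in>UNIV. poly (q i) z ^ \<alpha> i)"
      if "\<alpha> \<in> multi_indices n" for \<alpha>
    proof -
      have "z ^ n = z ^ (n - (\<Sum>i\<in>UNIV. \<alpha> i)) * (\<Prod>i\<in>UNIV. z ^ \<alpha> i)"
        using that by (simp add: multi_indices_def power_sum[symmetric] power_add[symmetric])
      then show ?thesis
        by (simp add: monomial_def coord[symmetric] power_mult_distrib prod.distrib mult_ac del: vector_add_component vector_scaleR_component)
    qed
    then have "complex_of_real (p (c + cos t *\<^sub>R u + sin t *\<^sub>R v)) * z ^ n = poly Q z"
      by (simp add: p Q_def poly_sum poly_prod poly_monom sum_distrib_right mult.assoc)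
    then show ?thesis
      unfolding zn z_def[symmetric] using z0 by (simp add: field_simps)
  qed
  show thesis
    by (rule that[OF deg_Q]) (rule allI, rule eq_Q)
qed

text \<open>
  On the ellipse, \<open>p\<close> is a trigonometric polynomial in the angle. The case \<open>v = 0\<close> matters as well: the
  ellipse is then a segment, traversed with vanishing speed at its ends, and near these ends the angle
  measures the square root of the distance to the end.
\<close>

lemma bernstein_ellipse:
  fixes c u v :: "real ^ 'n"
  assumes p: "p \<in> poly_space n" and n: "0 < n"
    and M: "\<And>t. \<bar>p (c + cos t *\<^sub>R u + sin t *\<^sub>R v)\<bar> \<le> M"
  shows "\<bar>p (c + cos t *\<^sub>R u + sin t *\<^sub>R v) - p (c + cos s *\<^sub>R u + sin s *\<^sub>R v)\<bar> \<le> 3 * real n * M * \<bar>t - s\<bar>"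
proof -
  define P where "P t = p (c + cos t *\<^sub>R u + sin t *\<^sub>R v)" for t
  obtain Q where deg: "degree Q \<le> 2 * n"
    and Q': "\<forall>t. complex_of_real (p (c + cos t *\<^sub>R u + sin t *\<^sub>R v)) =
        exp (- (\<i> * of_nat n * of_real t)) * poly Q (exp (\<i> * of_real t))"
    by (rule poly_space_on_ellipse[OF p, where c = c and u = u and v = v])
  have Q: "complex_of_real (P t) = exp (- (\<i> * of_nat n * of_real t)) * poly Q (exp (\<i> * of_real t))" for t
    using Q' by (simp only: P_def)
  have "norm (poly Q z) \<le> M" if "norm z = 1" for z
  proof -
    have "exp (\<i> * of_real (Arg2pi z)) = z"
      using that by (simp only: complex_norm_eq_1_exp)
    then obtain t where z: "z = exp (\<i> * of_real t)"
      by (rule that[OF sym])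
    have "norm (poly Q z) = norm (complex_of_real (P t))"
      unfolding Q by (simp add: norm_mult z)
    also have "\<dots> \<le> M"
      using M[of t] by (simp add: P_def)
    finally show ?thesis .
  qed
  then have "norm (complex_of_real (P t) - complex_of_real (P s)) \<le> 3 * real n * M * \<bar>t - s\<bar>"
    unfolding Q using deg n by (rule trig_poly_lipschitz)
  then show ?thesis
    by (simp add: P_def flip: of_real_diff)
qed

text \<open>
  On each line through \<open>a\<close> the polynomial is a univariate polynomial that vanishes on an interval.
\<close>

lemma poly_space_zero_if_zero_on_open:
  fixes p :: "real ^ 'n \<Rightarrow> real"
  assumes p: "p \<in> poly_space n" and S: "open S" "a \<in> S" and zero: "\<And>x. x \<in> S \<Longrightarrow> p x = 0"
  shows "p = (\<lambda>x. 0)"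
proof
  fix x
  obtain b where b: "p = (\<lambda>x. \<Sum>\<alpha>\<in>multi_indices n. b \<alpha> * monomial \<alpha> x)"
    using p by (rule poly_space_cases)
  define q where "q = (\<Sum>\<alpha>\<in>multi_indices n. smult (b \<alpha>) (\<Prod>i\<in>UNIV. [:a $ i, x $ i - a $ i:] ^ \<alpha> i))"
  have q: "poly q t = p (a + t *\<^sub>R (x - a))" for t
    by (simp add: q_def b poly_sum poly_prod monomial_def)
  have "open ((\<lambda>t. a + t *\<^sub>R (x - a)) -` S)"
    using S by (intro continuous_open_vimage continuous_intros)
  moreover have "0 \<in> (\<lambda>t. a + t *\<^sub>R (x - a)) -` S"
    using S by simp
  ultimately obtain e where "e > 0" and e: "ball 0 e \<subseteq> (\<lambda>t. a + t *\<^sub>R (x - a)) -` S"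
    using open_contains_ball by blast
  have "{0<..<e} \<subseteq> {t. poly q t = 0}"
    using e zero by (force simp: q)
  then have "infinite {t. poly q t = 0}"
    using \<open>e > 0\<close> infinite_Ioo finite_subset by blast
  then have "q = 0"
    using poly_roots_finite by blast
  then show "p x = 0"
    using q[of 1] by simp
qed

section \<open>From local to global meshes\<close>

text \<open>
  Cut the space into cubes of side \<open>\<eta> / (d * N)\<close> and choose one point of \<open>X\<close> in each cube that meets
  \<open>X\<close>. Choosing the points inside \<open>X\<close> rather than on the grid lets \<open>X\<close> be an arbitrary parameter
  domain.
\<close>

lemma bounded_has_net:
  fixes X :: "(real ^ 'n) set"
  assumes X: "bounded X" and \<eta>: "0 < \<eta>"
  obtains C :: nat where "\<And>N. 0 < N \<Longrightarrow> \<exists>G\<subseteq>X. finite G \<and> card G \<le> C * N ^ CARD('n) \<and>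
    (\<forall>x\<in>X. \<exists>g\<in>G. norm (x - g) \<le> \<eta> / real N)"
proof -
  obtain B where B: "\<And>x. x \<in> X \<Longrightarrow> norm x \<le> B" and B0: "0 < B"
    using X by (auto simp: bounded_pos)
  define b where "b = nat \<lceil>B * real CARD('n) / \<eta>\<rceil>"
  show thesis
  proof (rule that[of "(2 * b + 1) ^ CARD('n)"])
    fix N :: nat assume N: "0 < N"
    define \<delta> where "\<delta> = \<eta> / (real CARD('n) * real N)"
    have \<delta>: "0 < \<delta>"
      using \<eta> N by (simp add: \<delta>_def)
    define cell :: "real ^ 'n \<Rightarrow> 'n \<Rightarrow> int" where "cell x i = \<lfloor>x $ i / \<delta>\<rfloor>" for x i
    define G where "G = inv_into X cell ` cell ` X"
    have "cell x i \<in> {- int (b * N)..int (b * N)}" if "x \<in> X" for x i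
    proof -
      have "\<bar>x $ i / \<delta>\<bar> \<le> B / \<delta>"
        using component_le_norm_cart[of x i] B[OF that] \<delta> by (simp add: divide_right_mono)
      also have "\<dots> = B * real CARD('n) / \<eta> * real N"
        by (simp add: \<delta>_def)
      also have "\<dots> \<le> real b * real N"
        unfolding b_def by (intro mult_right_mono of_nat_ceiling) auto
      finally have "- (real b * real N) \<le> x $ i / \<delta>" "x $ i / \<delta> < real b * real N + 1"
        by linarith+
      then show ?thesis
        by (simp add: cell_def le_floor_iff floor_le_iff)
    qed
    then have sub: "cell ` X \<subseteq> Pi\<^sub>E UNIV (\<lambda>_. {- int (b * N)..int (b * N)})"
      by auto
    have fin: "finite (Pi\<^sub>E UNIV (\<lambda>_::'n. {- int (b * N)..int (b * N)}))"
      by (intro finite_PiE) auto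
    then have finc: "finite (cell ` X)"
      using sub by (rule finite_subset[rotated])
    have "card G \<le> card (cell ` X)"
      unfolding G_def by (rule card_image_le[OF finc])
    also have "\<dots> \<le> card (Pi\<^sub>E UNIV (\<lambda>_::'n. {- int (b * N)..int (b * N)}))"
      using fin sub by (rule card_mono)
    also have "\<dots> = (2 * (b * N) + 1) ^ CARD('n)"
      by (simp add: card_PiE nat_add_distrib nat_mult_distrib algebra_simps)
    also have "\<dots> \<le> ((2 * b + 1) * N) ^ CARD('n)"
      using N by (intro power_mono) (auto simp: algebra_simps)
    finally have card: "card G \<le> (2 * b + 1) ^ CARD('n) * N ^ CARD('n)"
      by (simp only: power_mult_distrib)
    have "\<exists>g\<in>G. norm (x - g) \<le> \<eta> / real N" if x: "x \<in> X" for x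
    proof
      let ?g = "inv_into X cell (cell x)"
      show "?g \<in> G"
        using x by (auto simp: G_def)
      have "cell ?g = cell x"
        using x by (intro f_inv_into_f) auto
      then have eq: "\<lfloor>?g $ i / \<delta>\<rfloor> = \<lfloor>x $ i / \<delta>\<rfloor>" for i
        by (simp add: cell_def fun_eq_iff)
      have "\<bar>(x - ?g) $ i\<bar> \<le> \<delta>" for i
      proof -
        have "\<bar>x $ i / \<delta> - ?g $ i / \<delta>\<bar> \<le> 1"
          using eq[of i] by linarith
        then show ?thesis
          using \<delta> by (simp add: diff_divide_distrib[symmetric])
      qed
      then have "(\<Sum>i\<in>UNIV. \<bar>(x - ?g) $ i\<bar>) \<le> real CARD('n) * \<delta>"
        using sum_bounded_above[of UNIV "\<lambda>i. \<bar>(x - ?g) $ i\<bar>" \<delta>] by simp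
      then show "norm (x - ?g) \<le> \<eta> / real N"
        using norm_le_l1_cart[of "x - ?g"] N by (simp add: \<delta>_def)
    qed
    moreover have "G \<subseteq> X"
      by (auto simp: G_def intro: inv_into_into)
    moreover have "finite G"
      unfolding G_def using finc by simp
    ultimately show "\<exists>G\<subseteq>X. finite G \<and> card G \<le> (2 * b + 1) ^ CARD('n) * N ^ CARD('n) \<and>
        (\<forall>x\<in>X. \<exists>g\<in>G. norm (x - g) \<le> \<eta> / real N)"
      using card by blast
  qed
qed

text \<open>
  The factor \<open>1 / 2\<close> is what makes the notion self-improving: if \<open>S = K\<close> and \<open>M\<close> is the supremum of
  \<open>\<bar>p\<bar>\<close> on \<open>K\<close>, the term \<open>M / 2\<close> can be absorbed on the left, whereas the bound \<open>M\<close> over all of \<open>K\<close>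
  allows the condition itself to be checked on small pieces \<open>S\<close> separately.
\<close>

definition half_mesh :: "(real ^ 'n) set \<Rightarrow> nat \<Rightarrow> (real ^ 'n) set \<Rightarrow> (real ^ 'n) set \<Rightarrow> bool" where
  "half_mesh K N S A \<longleftrightarrow> finite A \<and> A \<subseteq> K \<and>
     (\<forall>p\<in>poly_space N. \<forall>M. (\<forall>y\<in>K. \<bar>p y\<bar> \<le> M) \<longrightarrow> (\<forall>x\<in>S. \<exists>a\<in>A. \<bar>p x - p a\<bar> \<le> M / 2))"

definition meshable_in :: "(real ^ 'n) set \<Rightarrow> (real ^ 'n) set \<Rightarrow> bool" where
  "meshable_in K S \<longleftrightarrow> (\<exists>C. \<forall>N>0. \<exists>A. half_mesh K N S A \<and> card A \<le> C * N ^ CARD('n))"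

lemma half_meshI:
  assumes "finite A" "A \<subseteq> K"
    and "\<And>p M x. p \<in> poly_space N \<Longrightarrow> (\<And>y. y \<in> K \<Longrightarrow> \<bar>p y\<bar> \<le> M) \<Longrightarrow> x \<in> S \<Longrightarrow> \<exists>a\<in>A. \<bar>p x - p a\<bar> \<le> M / 2"
  shows "half_mesh K N S A"
  using assms unfolding half_mesh_def by simp

lemma half_meshD:
  assumes "half_mesh K N S A" "p \<in> poly_space N" "\<And>y. y \<in> K \<Longrightarrow> \<bar>p y\<bar> \<le> M" "x \<in> S"
  obtains a where "a \<in> A" "\<bar>p x - p a\<bar> \<le> M / 2"
  using assms unfolding half_mesh_def by meson

lemma half_mesh_Un:
  assumes "half_mesh K N S A" "half_mesh K N T B" shows "half_mesh K N (S \<union> T) (A \<union> B)"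
proof (rule half_meshI)
  show "finite (A \<union> B)" "A \<union> B \<subseteq> K"
    using assms by (auto simp: half_mesh_def)
  fix p M x assume p: "p \<in> poly_space N" and M: "\<And>y. y \<in> K \<Longrightarrow> \<bar>p y\<bar> \<le> M" and "x \<in> S \<union> T"
  then consider "x \<in> S" | "x \<in> T"
    by blast
  then show "\<exists>a\<in>A \<union> B. \<bar>p x - p a\<bar> \<le> M / 2"
  proof cases
    case 1
    with assms(1) p M obtain a where "a \<in> A" "\<bar>p x - p a\<bar> \<le> M / 2"
      by (rule half_meshD)
    then show ?thesis
      by blast
  next
    case 2
    with assms(2) p M obtain a where "a \<in> B" "\<bar>p x - p a\<bar> \<le> M / 2"
      by (rule half_meshD)
    then show ?thesis
      by blast
  qed
qed

lemma half_mesh_mono: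
  assumes "half_mesh K N S A" "S' \<subseteq> S" shows "half_mesh K N S' A"
  using assms unfolding half_mesh_def by (simp add: subset_iff)

text \<open>
  This reduces the construction of a mesh to a good choice of coordinates \<open>\<Psi>\<close>: once polynomials of
  degree \<open>N\<close> are Lipschitz with a constant proportional to \<open>N\<close> in these coordinates, the image of a
  net of mesh width \<open>\<eta> / N\<close> with small \<open>\<eta>\<close> serves.
\<close>

lemma meshable_in_image:
  fixes \<Psi> :: "real ^ 'n \<Rightarrow> real ^ 'n" and C :: real
  assumes X: "bounded X" and K: "\<Psi> ` X \<subseteq> K" and S: "S \<subseteq> \<Psi> ` X" and pos: "0 < C" "0 < \<tau>"
    and lip: "\<And>N p M x x'. 0 < N \<Longrightarrow> p \<in> poly_space N \<Longrightarrow> (\<And>y. y \<in> K \<Longrightarrow> \<bar>p y\<bar> \<le> M) \<Longrightarrow>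
      x \<in> X \<Longrightarrow> x' \<in> X \<Longrightarrow> norm (x - x') \<le> \<tau> \<Longrightarrow>
      \<bar>p (\<Psi> x) - p (\<Psi> x')\<bar> \<le> C * real N * M * norm (x - x')"
  shows "meshable_in K S"
proof -
  define \<eta> where "\<eta> = min \<tau> (1 / (2 * C))"
  have \<eta>: "0 < \<eta>" "\<eta> \<le> \<tau>" "C * \<eta> \<le> 1 / 2"
    using pos by (auto simp: \<eta>_def min_def field_simps)
  obtain c where c: "\<And>N. 0 < N \<Longrightarrow> \<exists>G\<subseteq>X. finite G \<and> card G \<le> c * N ^ CARD('n) \<and>
      (\<forall>x\<in>X. \<exists>g\<in>G. norm (x - g) \<le> \<eta> / real N)"
    using bounded_has_net[OF X \<eta>(1)] by blast
  have "\<exists>A. half_mesh K N S A \<and> card A \<le> c * N ^ CARD('n)" if N: "0 < N" for N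
  proof -
    obtain G where G: "G \<subseteq> X" "finite G" "card G \<le> c * N ^ CARD('n)"
      and net: "\<forall>x\<in>X. \<exists>g\<in>G. norm (x - g) \<le> \<eta> / real N"
      using c[OF N] by blast
    have "half_mesh K N S (\<Psi> ` G)"
    proof (rule half_meshI)
      show "finite (\<Psi> ` G)" "\<Psi> ` G \<subseteq> K"
        using G K by auto
      fix p M x assume p: "p \<in> poly_space N" and M: "\<And>y. y \<in> K \<Longrightarrow> \<bar>p y\<bar> \<le> M" and "x \<in> S"
      obtain w where w: "w \<in> X" "x = \<Psi> w"
        using \<open>x \<in> S\<close> S by blast
      obtain g where g: "g \<in> G" "norm (w - g) \<le> \<eta> / real N"
        using net w by blast
      have "x \<in> K"
        using K w by blast
      then have M0: "0 \<le> M"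
        using M[of x] by linarith
      have "\<eta> / real N \<le> \<eta> / 1"
        using N \<eta> by (intro divide_left_mono) auto
      then have "norm (w - g) \<le> \<tau>"
        using g \<eta> by linarith
      then have "\<bar>p x - p (\<Psi> g)\<bar> \<le> C * real N * M * norm (w - g)"
        unfolding w using g G w by (intro lip N p M) auto
      also have "\<dots> \<le> C * real N * M * (\<eta> / real N)"
        using g pos M0 by (intro mult_left_mono) auto
      also have "\<dots> = (C * \<eta>) * M"
        using N by simp
      also have "\<dots> \<le> 1 / 2 * M"
        using \<eta> M0 by (intro mult_right_mono)
      finally show "\<exists>a\<in>\<Psi> ` G. \<bar>p x - p a\<bar> \<le> M / 2"
        using g by auto
    qed
    moreover have "card (\<Psi> ` G) \<le> c * N ^ CARD('n)"
      using card_image_le[OF G(2), of \<Psi>] G(3) by linarith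
    ultimately show ?thesis
      by blast
  qed
  then show ?thesis
    unfolding meshable_in_def by blast
qed

lemma meshable_in_mono:
  assumes "meshable_in K S" "S' \<subseteq> S" shows "meshable_in K S'"
  using assms half_mesh_mono unfolding meshable_in_def by meson

lemma meshable_in_Un:
  fixes K S T :: "(real ^ 'n) set"
  assumes "meshable_in K S" "meshable_in K T" shows "meshable_in K (S \<union> T)"
proof -
  obtain C where C: "\<And>N. 0 < N \<Longrightarrow> \<exists>A. half_mesh K N S A \<and> card A \<le> C * N ^ CARD('n)"
    using assms(1) unfolding meshable_in_def by blast
  obtain D where D: "\<And>N. 0 < N \<Longrightarrow> \<exists>A. half_mesh K N T A \<and> card A \<le> D * N ^ CARD('n)"
    using assms(2) unfolding meshable_in_def by blast
  have "\<exists>A. half_mesh K N (S \<union> T) A \<and> card A \<le> (C + D) * N ^ CARD('n)" if N: "0 < N" for N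
  proof -
    obtain A B where "half_mesh K N S A" "card A \<le> C * N ^ CARD('n)"
      "half_mesh K N T B" "card B \<le> D * N ^ CARD('n)"
      using C[OF N] D[OF N] by blast
    moreover from this have "card (A \<union> B) \<le> (C + D) * N ^ CARD('n)"
      using card_Un_le[of A B] by (simp add: add_mult_distrib)
    ultimately show ?thesis
      using half_mesh_Un by blast
  qed
  then show ?thesis
    unfolding meshable_in_def by blast
qed

lemma meshable_in_empty: "meshable_in K {}"
  unfolding meshable_in_def half_mesh_def by (auto intro!: exI[of _ "{}"])

lemma meshable_in_Union:
  assumes "finite \<S>" "\<And>S. S \<in> \<S> \<Longrightarrow> meshable_in K S" shows "meshable_in K (\<Union>\<S>)"
  using assms by (induction \<S> rule: finite_induct) (auto intro: meshable_in_empty meshable_in_Un)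

text \<open>
  Meshes of finitely many pieces can be united, so compactness makes the problem local.
\<close>

lemma meshable_in_if_locally:
  assumes K: "compact K" and loc: "\<And>z. z \<in> K \<Longrightarrow> \<exists>U. open U \<and> z \<in> U \<and> meshable_in K (K \<inter> U)"
  shows "meshable_in K K"
proof -
  have "K \<subseteq> \<Union>{U. open U \<and> meshable_in K (K \<inter> U)}"
    using loc by blast
  with K obtain \<U> where \<U>: "\<U> \<subseteq> {U. open U \<and> meshable_in K (K \<inter> U)}" "finite \<U>" "K \<subseteq> \<Union>\<U>"
    by (rule compactE) auto
  have "meshable_in K (\<Union>((\<inter>) K ` \<U>))"
    using \<U> by (intro meshable_in_Union) auto
  then show ?thesis
    by (rule meshable_in_mono) (use \<U> in auto)
qed

text \<open>
  The set used for degree \<open>n\<close> is the one built for degree \<open>n + 1\<close>, since \<open>meshable_in\<close> speaks of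
  positive degrees only. The mesh constant is \<open>2\<close>: the bound
  \<open>\<bar>p x\<bar> \<le> sup_norm_on A p + M / 2\<close> for all \<open>x\<close> in \<open>K\<close> gives \<open>M \<le> sup_norm_on A p + M / 2\<close>.
\<close>

lemma optimal_admissible_mesh_if_meshable:
  fixes K :: "(real ^ 'n) set"
  assumes cpt: "compact K" and ne: "K \<noteq> {}" and det: "polynomial_determining K" and mesh: "meshable_in K K"
  shows "\<exists>A. optimal_admissible_mesh K A"
proof -
  obtain C where "\<forall>N>0. \<exists>A. half_mesh K N K A \<and> card A \<le> C * N ^ CARD('n)"
    using mesh unfolding meshable_in_def by blast
  then have "\<forall>n. \<exists>A. half_mesh K (Suc n) K A \<and> card A \<le> C * Suc n ^ CARD('n)"
    by blast
  then obtain A where A: "\<And>n. half_mesh K (Suc n) K (A n)" and card: "\<And>n. card (A n) \<le> C * Suc n ^ CARD('n)"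
    by (auto dest!: choice)
  have fin: "finite (A n)" and sub: "A n \<subseteq> K" for n
    using A[of n] by (simp_all add: half_mesh_def)
  have "real (card (A n)) \<le> real (C * 2 ^ CARD('n)) * real n ^ CARD('n)" if "1 \<le> n" for n
  proof -
    have "card (A n) \<le> C * Suc n ^ CARD('n)"
      by (rule card)
    also have "\<dots> \<le> C * (2 * n) ^ CARD('n)"
      using that by (intro mult_left_mono power_mono) auto
    finally have "card (A n) \<le> C * 2 ^ CARD('n) * n ^ CARD('n)"
      by (simp add: power_mult_distrib)
    then show ?thesis
      by (metis of_nat_le_iff of_nat_mult of_nat_power)
  qed
  then have O: "(\<lambda>n. real (card (A n))) \<in> O(\<lambda>n. real n ^ CARD('n))"
    by (intro bigoI[where c = "real (C * 2 ^ CARD('n))"] eventually_sequentiallyI[of 1]) auto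
  have "sup_norm_on K p \<le> 2 * sup_norm_on (A n) p" if p: "p \<in> poly_space n" for n p
  proof -
    define M where "M = sup_norm_on K p"
    have "compact ((\<lambda>x. \<bar>p x\<bar>) ` K)"
      using continuous_on_poly_space[OF p] cpt by (intro compact_continuous_image continuous_intros)
    then have "bdd_above ((\<lambda>x. \<bar>p x\<bar>) ` K)"
      by (intro bounded_imp_bdd_above compact_imp_bounded)
    then have M: "\<bar>p x\<bar> \<le> M" if "x \<in> K" for x
      unfolding M_def sup_norm_on_def using that by (intro cSUP_upper)
    have "\<bar>p x\<bar> \<le> sup_norm_on (A n) p + M / 2" if x: "x \<in> K" for x
    proof -
      obtain a where a: "a \<in> A n" "\<bar>p x - p a\<bar> \<le> M / 2"
        using half_meshD[OF A[of n] subsetD[OF poly_space_mono[of n "Suc n"] p, simplified] M x] by blast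
      moreover have "\<bar>p a\<bar> \<le> sup_norm_on (A n) p"
        unfolding sup_norm_on_def using fin[of n] a by (intro cSUP_upper) auto
      ultimately show ?thesis
        by linarith
    qed
    then have "M \<le> sup_norm_on (A n) p + M / 2"
      unfolding M_def sup_norm_on_def[of K] using ne by (intro cSUP_least) auto
    then show ?thesis
      unfolding M_def by linarith
  qed
  then have "admissible_mesh K (\<lambda>n. A n)"
    unfolding admissible_mesh_def using cpt det fin sub O by (auto intro!: exI[of _ "2::real"])
  then show ?thesis
    unfolding optimal_admissible_mesh_def using O by blast
qed

section \<open>Moving along ellipses inside the domain\<close>

text \<open>
  Ellipses are parametrised by angle, whereas the moves below are measured by lengths. Staying away
  from the turning points \<open>\<plusminus>1\<close> makes the two comparable.
\<close>

lemma arcsin_lipschitz: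
  assumes "\<bar>a\<bar> \<le> 3 / 4" "\<bar>b\<bar> \<le> 3 / 4"
  shows "\<bar>arcsin a - arcsin b\<bar> \<le> 2 * \<bar>a - b\<bar>"
proof -
  have "norm (arcsin a - arcsin b) \<le> 2 * norm (a - b)"
  proof (rule field_differentiable_bound[where S = "{-3/4..3/4}"])
    fix x :: real assume x: "x \<in> {-3/4..3/4}"
    show "(arcsin has_field_derivative inverse (sqrt (1 - x\<^sup>2))) (at x within {-3/4..3/4})"
      using x by (auto intro: has_field_derivative_at_within[OF DERIV_arcsin])
    have "x\<^sup>2 \<le> (3 / 4)\<^sup>2"
      using x by (subst abs_le_square_iff[symmetric]) auto
    then have "1 / 2 \<le> sqrt (1 - x\<^sup>2)"
      by (intro real_le_rsqrt) (simp add: power2_eq_square)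
    then have "inverse (sqrt (1 - x\<^sup>2)) \<le> inverse (1 / 2)"
      by (intro le_imp_inverse_le) auto
    then show "norm (inverse (sqrt (1 - x\<^sup>2))) \<le> 2"
      using \<open>1 / 2 \<le> sqrt (1 - x\<^sup>2)\<close> by simp
  qed (use assms in auto)
  then show ?thesis
    by simp
qed

lemma arcsin_le_double:
  assumes "0 \<le> a" "a \<le> 1 / 2" shows "0 \<le> arcsin a" "arcsin a \<le> 2 * a"
proof -
  have "arcsin 0 \<le> arcsin a"
    using assms by (intro arcsin_le_arcsin) auto
  then show "0 \<le> arcsin a"
    by simp
  then show "arcsin a \<le> 2 * a"
    using arcsin_lipschitz[of a 0] assms by simp
qed

text \<open>
  Two nearby points of the ball lie on a segment of half-length \<open>\<rho>\<close> centred at one of them and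
  contained in \<open>K\<close>. At its centre a segment is traversed at full speed, so no change of coordinates
  is needed.
\<close>

lemma meshable_in_interior:
  fixes z :: "real ^ 'n"
  assumes \<rho>: "0 < \<rho>" and K: "ball z (2 * \<rho>) \<subseteq> K"
  shows "meshable_in K (ball z \<rho>)"
proof (rule meshable_in_image[where \<Psi> = "\<lambda>x. x" and X = "ball z \<rho>" and C = "6 / \<rho>" and \<tau> = "\<rho> / 2"])
  fix N :: nat and p M and x x' :: "real ^ 'n"
  assume N: "0 < N" and p: "p \<in> poly_space N" and M: "\<And>y. y \<in> K \<Longrightarrow> \<bar>p y\<bar> \<le> M"
    and x: "x \<in> ball z \<rho>" and x': "x' \<in> ball z \<rho>" and \<tau>: "norm (x - x') \<le> \<rho> / 2"
  show "\<bar>p x - p x'\<bar> \<le> 6 / \<rho> * real N * M * norm (x - x')"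
  proof (cases "x = x'")
    case False
    define \<tau> where "\<tau> = norm (x - x')"
    have \<tau>0: "0 < \<tau>" "\<tau> \<le> \<rho> / 2"
      using False \<tau> by (auto simp: \<tau>_def)
    define w where "w = (\<rho> / \<tau>) *\<^sub>R (x' - x)"
    have w: "norm w = \<rho>"
      using \<tau>0 \<rho> by (simp add: w_def \<tau>_def norm_minus_commute)
    define t where "t = arcsin (\<tau> / \<rho>)"
    have ratio: "0 \<le> \<tau> / \<rho>" "\<tau> / \<rho> \<le> 1 / 2"
      using \<tau>0 \<rho> by (auto simp: field_simps)
    note t = arcsin_le_double[OF ratio, folded t_def]
    have sin_t: "sin t = \<tau> / \<rho>"
      unfolding t_def using ratio by (intro sin_arcsin) linarith+
    have "x + cos t *\<^sub>R 0 + sin t *\<^sub>R w \<in> K" for t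
    proof -
      have "norm (sin t *\<^sub>R w) \<le> 1 * \<rho>"
        unfolding norm_scaleR w using \<rho> by (intro mult_right_mono) auto
      then have "dist z (x + sin t *\<^sub>R w) < 2 * \<rho>"
        using x \<rho> norm_triangle_ineq[of "x - z" "sin t *\<^sub>R w"]
        by (simp add: dist_norm norm_minus_commute[of z] algebra_simps)
      then show ?thesis
        using K by auto
    qed
    then have "\<bar>p (x + cos 0 *\<^sub>R 0 + sin 0 *\<^sub>R w) - p (x + cos t *\<^sub>R 0 + sin t *\<^sub>R w)\<bar> \<le> 3 * real N * M * \<bar>0 - t\<bar>"
      by (intro bernstein_ellipse[OF p N] M)
    moreover have "x + cos t *\<^sub>R 0 + sin t *\<^sub>R w = x'"
      using \<tau>0 \<rho> by (simp add: w_def sin_t)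
    moreover have "3 * real N * M * \<bar>0 - t\<bar> \<le> 3 * real N * M * (2 * (\<tau> / \<rho>))"
    proof (rule mult_left_mono)
      have "x \<in> K"
        using x K \<rho> by auto
      then show "0 \<le> 3 * real N * M"
        using M[of x] by simp
    qed (use t in simp)
    ultimately show ?thesis
      by (simp add: \<tau>_def mult_ac)
  qed simp
qed (use \<rho> K in auto)

text \<open>
  Near the end of a segment that cannot be prolonged inside \<open>K\<close>, the point at height \<open>s\<close> corresponds to
  an angle of order \<open>sqrt s\<close>, because \<open>s = h / 2 * (1 - cos t) = h * (sin (t / 2))\<^sup>2\<close>. Keeping to the
  lower half of the segment excludes its other end.
\<close>

lemma bernstein_segment_end:
  fixes q e :: "real ^ 'n"
  assumes p: "p \<in> poly_space N" and N: "0 < N" and h: "0 < h"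
    and M: "\<And>s. 0 \<le> s \<Longrightarrow> s \<le> h \<Longrightarrow> \<bar>p (q + s *\<^sub>R e)\<bar> \<le> M"
    and s: "0 \<le> s" "s \<le> h / 2" and s': "0 \<le> s'" "s' \<le> h / 2"
  shows "\<bar>p (q + s *\<^sub>R e) - p (q + s' *\<^sub>R e)\<bar> \<le> 12 / sqrt h * real N * M * \<bar>sqrt s - sqrt s'\<bar>"
proof -
  define a where "a s = arcsin (sqrt (s / h))" for s
  let ?E = "\<lambda>t. (q + (h / 2) *\<^sub>R e) + cos t *\<^sub>R (- (h / 2) *\<^sub>R e) + sin t *\<^sub>R 0"
  have E: "?E t = q + (h / 2 * (1 - cos t)) *\<^sub>R e" for t
  proof -
    have "h / 2 * (1 - cos t) = h / 2 + cos t * - (h / 2)"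
      by (simp add: field_simps)
    then show ?thesis
      by (simp only: scaleR_add_left scaleR_scaleR scaleR_zero_right add_0_right add.assoc)
  qed
  have ratio: "0 \<le> sqrt (s / h)" "sqrt (s / h) \<le> 3 / 4" if "0 \<le> s" "s \<le> h / 2" for s
  proof -
    have "s / h \<le> 1 / 2"
      using that h by (simp add: field_simps)
    also have "\<dots> \<le> (3 / 4)\<^sup>2"
      by (simp add: power2_eq_square)
    finally have "s / h \<le> (3 / 4)\<^sup>2" .
    then show "sqrt (s / h) \<le> 3 / 4"
      by (intro real_le_lsqrt) auto
    show "0 \<le> sqrt (s / h)"
      using that h by simp
  qed
  have E_a: "?E (2 * a s) = q + s *\<^sub>R e" if "0 \<le> s" "s \<le> h / 2" for s
  proof -
    have "sin (a s) = sqrt (s / h)"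
      unfolding a_def using ratio[OF that] by (intro sin_arcsin) linarith+
    then have "cos (2 * a s) = 1 - 2 * (s / h)"
      using that h by (simp add: cos_double_sin)
    then show ?thesis
      unfolding E using h by simp
  qed
  have "\<bar>p (?E t)\<bar> \<le> M" for t
    unfolding E
  proof (rule M)
    have "h / 2 * (1 - cos t) \<le> h / 2 * 2"
      using h cos_ge_minus_one[of t] by (intro mult_left_mono) linarith+
    then show "h / 2 * (1 - cos t) \<le> h"
      by simp
  qed (use h in simp)
  then have "\<bar>p (?E (2 * a s)) - p (?E (2 * a s'))\<bar> \<le> 3 * real N * M * \<bar>2 * a s - 2 * a s'\<bar>"
    by (rule bernstein_ellipse[OF p N])
  also have "\<dots> \<le> 3 * real N * M * (4 * \<bar>sqrt (s / h) - sqrt (s' / h)\<bar>)"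
  proof (rule mult_left_mono)
    have "\<bar>a s - a s'\<bar> \<le> 2 * \<bar>sqrt (s / h) - sqrt (s' / h)\<bar>"
      unfolding a_def using ratio[OF s] ratio[OF s'] by (intro arcsin_lipschitz) linarith+
    then show "\<bar>2 * a s - 2 * a s'\<bar> \<le> 4 * \<bar>sqrt (s / h) - sqrt (s' / h)\<bar>"
      by linarith
    show "0 \<le> 3 * real N * M"
      using M[of 0] h by simp
  qed
  also have "\<bar>sqrt (s / h) - sqrt (s' / h)\<bar> = \<bar>sqrt s - sqrt s'\<bar> / sqrt h"
    using h by (simp add: real_sqrt_divide flip: diff_divide_distrib)
  finally show ?thesis
    unfolding E_a[OF s] E_a[OF s'] by (simp add: mult_ac)
qed

text \<open>
  A point at height \<open>s\<close> above the graph of \<open>f\<close> at \<open>y\<close> is moved over \<open>y'\<close> along the ellipse that starts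
  parallel to the tangent plane of the graph and curves upwards by \<open>m * (1 - cos t)\<close>. The graph departs
  from its tangent plane by at most \<open>L * (r / 2 * sin t)\<^sup>2\<close>, and
  \<open>(sin t)\<^sup>2 = (1 - cos t) * (1 + cos t) \<le> 2 * (1 - cos t)\<close>, so with \<open>m = L * r\<^sup>2 / 2\<close> the whole
  ellipse keeps at least the height \<open>s\<close>, even when \<open>s = 0\<close>. The price is that it arrives over \<open>y'\<close> not
  at the height \<open>s\<close> but somewhat higher; the excess is quadratic in the distance travelled.
\<close>

lemma bernstein_tangential:
  fixes T :: "real ^ 'n \<Rightarrow> real ^ 'n" and e z :: "real ^ 'n" and f :: "real ^ 'n \<Rightarrow> real"
  defines "\<Phi> \<equiv> \<lambda>y s. z + T y + (f y + s) *\<^sub>R e"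
  assumes p: "p \<in> poly_space N" and N: "0 < N" and T: "linear T"
    and r: "0 < r" and L: "0 \<le> L" "L * r\<^sup>2 \<le> h / 8"
    and taylor: "\<And>y'. y' \<in> hyperplane_ball k r \<Longrightarrow> \<bar>f y' - f y - g \<bullet> (y' - y)\<bar> \<le> L * (norm (y' - y))\<^sup>2"
    and M: "\<And>y s. y \<in> hyperplane_ball k r \<Longrightarrow> 0 \<le> s \<Longrightarrow> s \<le> h \<Longrightarrow> \<bar>p (\<Phi> y s)\<bar> \<le> M"
    and y: "y \<in> hyperplane_ball k (r / 2)" and y': "y' \<in> hyperplane_ball k r"
    and close: "norm (y' - y) \<le> r / 4" and s: "0 \<le> s" "s \<le> h / 4"
  shows "\<exists>\<sigma>. s \<le> \<sigma> \<and> \<sigma> \<le> h / 2 \<and> \<sigma> \<le> s + 4 * L * (norm (y' - y))\<^sup>2 \<and>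
    \<bar>p (\<Phi> y s) - p (\<Phi> y' \<sigma>)\<bar> \<le> 12 / r * real N * M * norm (y' - y)"
proof (cases "y = y'")
  case True
  have "0 \<le> L * r\<^sup>2"
    using L by simp
  then show ?thesis
    using True s L by (intro exI[of _ s]) auto
next
  case False
  define \<tau> where "\<tau> = norm (y' - y)"
  have \<tau>: "0 < \<tau>" "\<tau> \<le> r / 4"
    using False close by (auto simp: \<tau>_def)
  define w where "w = (r / 2 / \<tau>) *\<^sub>R (y' - y)"
  have w: "norm w = r / 2"
    using \<tau> r by (simp add: w_def \<tau>_def)
  define m where "m = L * r\<^sup>2 / 2"
  have m: "0 \<le> m" "m \<le> h / 16"
    using L by (auto simp: m_def)
  have yw: "y + sin t *\<^sub>R w \<in> hyperplane_ball k r" for t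
  proof -
    have "norm (sin t *\<^sub>R w) \<le> 1 * (r / 2)"
      unfolding norm_scaleR w using r by (intro mult_right_mono) auto
    moreover have "norm y < r / 2" "y $ k = 0" "y' $ k = 0"
      using y y' by (auto simp: hyperplane_ball_def coord_hyperplane_def)
    ultimately show ?thesis
      using norm_triangle_ineq[of y "sin t *\<^sub>R w"]
      by (auto simp: hyperplane_ball_def coord_hyperplane_def w_def)
  qed
  \<comment> \<open>The height above the graph at the angle \<open>t\<close>.\<close>
  define \<sigma> where "\<sigma> t = f y + s + m * (1 - cos t) + sin t * (g \<bullet> w) - f (y + sin t *\<^sub>R w)" for t
  have \<sigma>: "s \<le> \<sigma> t" "\<sigma> t \<le> s + 2 * m * (1 - cos t)" for t
  proof -
    have "\<bar>f (y + sin t *\<^sub>R w) - f y - sin t * (g \<bullet> w)\<bar> \<le> L * (norm (sin t *\<^sub>R w))\<^sup>2"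
      using taylor[OF yw[of t]] by simp
    also have "(norm (sin t *\<^sub>R w))\<^sup>2 = r\<^sup>2 / 4 * ((1 - cos t) * (1 + cos t))"
    proof -
      have "(sin t)\<^sup>2 = (1 - cos t) * (1 + cos t)"
        by (simp add: sin_squared_eq power2_eq_square algebra_simps)
      then show ?thesis
        by (simp add: power_mult_distrib w power_divide)
    qed
    also have "L * \<dots> \<le> L * (r\<^sup>2 / 4 * ((1 - cos t) * 2))"
      using L by (intro mult_left_mono) auto
    also have "\<dots> = m * (1 - cos t)"
      by (simp add: m_def)
    finally show "s \<le> \<sigma> t" "\<sigma> t \<le> s + 2 * m * (1 - cos t)"
      unfolding \<sigma>_def by (simp_all add: abs_le_iff)
  qed
  have \<sigma>h: "\<sigma> t \<le> h / 2" for t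
  proof -
    have "2 * m * (1 - cos t) \<le> 2 * m * 2"
      using m by (intro mult_left_mono) auto
    then show ?thesis
      using \<sigma>(2)[of t] s m by linarith
  qed
  let ?E = "\<lambda>t. (z + T y + (f y + s + m) *\<^sub>R e) + cos t *\<^sub>R (- m *\<^sub>R e) + sin t *\<^sub>R (T w + (g \<bullet> w) *\<^sub>R e)"
  have E: "?E t = \<Phi> (y + sin t *\<^sub>R w) (\<sigma> t)" for t
    unfolding \<Phi>_def \<sigma>_def using T by (simp add: linear_add linear_cmul algebra_simps)
  have "0 \<le> \<sigma> t \<and> \<sigma> t \<le> h" for t
    using \<sigma>(1)[of t] \<sigma>h[of t] s by linarith
  then have "\<bar>p (?E t)\<bar> \<le> M" for t
    unfolding E using yw by (intro M) auto
  then have "\<bar>p (?E 0) - p (?E t)\<bar> \<le> 3 * real N * M * \<bar>0 - t\<bar>" for t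
    by (rule bernstein_ellipse[OF p N])
  moreover have "?E 0 = \<Phi> y s"
    unfolding E by (simp add: \<sigma>_def)
  ultimately have move: "\<bar>p (\<Phi> y s) - p (\<Phi> (y + sin t *\<^sub>R w) (\<sigma> t))\<bar> \<le> 3 * real N * M * \<bar>t\<bar>" for t
    unfolding E by simp
  \<comment> \<open>The ellipse is over \<open>y'\<close> when \<open>r / 2 * sin t = \<tau>\<close>.\<close>
  define a where "a = 2 * \<tau> / r"
  have a: "0 \<le> a" "a \<le> 1 / 2"
    using \<tau> r by (auto simp: a_def field_simps)
  define t where "t = arcsin a"
  note t = arcsin_le_double[OF a, folded t_def]
  have sin_t: "sin t = a"
    unfolding t_def using a by (intro sin_arcsin) linarith+
  \<comment> \<open>This makes the gain in height quadratic in \<open>\<tau>\<close>.\<close>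
  have "1 - a\<^sup>2 \<le> cos t"
  proof -
    have a2: "0 \<le> 1 - a\<^sup>2" "1 - a\<^sup>2 \<le> 1"
      using a by (auto simp: power_le_one)
    have "cos t = sqrt (1 - a\<^sup>2)"
      unfolding t_def using a by (intro cos_arcsin) auto
    moreover have "(1 - a\<^sup>2)\<^sup>2 \<le> 1 - a\<^sup>2"
      using a2 by (simp add: power2_eq_square mult_left_le)
    ultimately show ?thesis
      by (simp add: real_le_rsqrt)
  qed
  then have "2 * m * (1 - cos t) \<le> 2 * m * a\<^sup>2"
    using m by (intro mult_left_mono) auto
  also have "\<dots> = 4 * L * \<tau>\<^sup>2"
    using r by (simp add: m_def a_def power_divide power_mult_distrib)
  finally have "\<sigma> t \<le> s + 4 * L * \<tau>\<^sup>2"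
    using \<sigma>(2)[of t] by linarith
  moreover have "y + sin t *\<^sub>R w = y'"
    using \<tau> r by (simp add: sin_t a_def w_def)
  moreover have "3 * real N * M * \<bar>t\<bar> \<le> 3 * real N * M * (2 * a)"
  proof (rule mult_left_mono)
    have "y \<in> hyperplane_ball k r"
      using yw[of 0] by simp
    then show "0 \<le> 3 * real N * M"
      using M[of y s] s m by simp
  qed (use t in simp)
  ultimately show ?thesis
    using \<sigma>(1)[of t] \<sigma>h[of t] move[of t] by (intro exI[of _ "\<sigma> t"]) (auto simp: \<tau>_def a_def mult_ac)
qed

section \<open>Meshing the region above a graph\<close>

text \<open>
  Coordinates that suit the boundary are the foot point \<open>y\<close> in the hyperplane and the square root of the
  height \<open>s\<close> above the graph; the latter is stored in the \<open>k\<close>-th coordinate, which is free. A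
  tangential move followed by a correction of the height along the segment over \<open>y'\<close> connects any two
  nearby points. The correction costs \<open>sqrt \<sigma> - sqrt s\<close> with \<open>\<sigma> \<le> s + 4 * L * \<tau>\<^sup>2\<close>, hence at most
  \<open>2 * sqrt L * \<tau>\<close>: the quadratic excess in height is linear in these coordinates. This is where the
  quadratic error in the Taylor estimate, and hence the \<open>C11\<close> regularity of the boundary, enters.
\<close>

lemma meshable_in_above_graph:
  fixes T :: "real ^ 'n \<Rightarrow> real ^ 'n" and e z :: "real ^ 'n" and k :: 'n and r h L :: real
  assumes T: "linear T" and r: "0 < r" and h: "0 < h" and L: "0 \<le> L" "L * r\<^sup>2 \<le> h / 8"
    and taylor: "\<And>y. y \<in> hyperplane_ball k r \<Longrightarrow>
      \<exists>g. \<forall>y'\<in>hyperplane_ball k r. \<bar>f y' - f y - g \<bullet> (y' - y)\<bar> \<le> L * (norm (y' - y))\<^sup>2"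
    and K: "\<And>y s. y \<in> hyperplane_ball k r \<Longrightarrow> 0 \<le> s \<Longrightarrow> s \<le> h \<Longrightarrow> z + T y + (f y + s) *\<^sub>R e \<in> K"
  shows "meshable_in K {z + T y + (f y + s) *\<^sub>R e |y s. y \<in> hyperplane_ball k (r / 2) \<and> 0 \<le> s \<and> s \<le> h / 4}"
    (is "meshable_in K ?S")
proof -
  define P where "P x = x - axis k (x $ k)" for x :: "real ^ 'n"
  define \<Phi> where "\<Phi> y s = z + T y + (f y + s) *\<^sub>R e" for y s
  define X where "X = {x. P x \<in> hyperplane_ball k (r / 2) \<and> 0 \<le> x $ k \<and> (x $ k)\<^sup>2 \<le> h / 4}"
  define \<Psi> where "\<Psi> x = \<Phi> (P x) ((x $ k)\<^sup>2)" for x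
  define V where "V = 12 / sqrt h"
  define C where "C = 12 / r + V * (2 * sqrt L + 1)"
  have V: "0 < V"
    using h by (simp add: V_def)
  have C: "0 < C"
    unfolding C_def using r V L by (intro add_pos_nonneg) auto
  have P_diff: "P x - P x' = P (x - x')" for x x'
    by (simp add: P_def vec_eq_iff axis_def)
  have norm_P: "norm (P x) \<le> norm x" for x
    by (rule norm_le_componentwise_cart) (simp add: P_def axis_def)
  have hb_mono: "y \<in> hyperplane_ball k r" if "y \<in> hyperplane_ball k (r / 2)" for y
    using that r by (auto simp: hyperplane_ball_def)
  show ?thesis
  proof (rule meshable_in_image[where \<Psi> = \<Psi> and X = X and C = C and \<tau> = "r / 4"])
    have "norm x \<le> r / 2 + sqrt (h / 4)" if "x \<in> X" for x
    proof -
      have "norm (P x) \<le> r / 2"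
        using that by (simp add: X_def hyperplane_ball_def)
      moreover have "\<bar>x $ k\<bar> \<le> sqrt (h / 4)"
        using that by (intro real_le_rsqrt) (simp add: X_def)
      moreover have "norm x \<le> norm (P x) + norm (axis k (x $ k))"
        using norm_triangle_ineq[of "P x" "axis k (x $ k)"] by (simp add: P_def)
      moreover have "norm (axis k (x $ k)) = \<bar>x $ k\<bar>"
        by (simp add: norm_eq_sqrt_inner inner_axis_axis)
      ultimately show ?thesis
        by linarith
    qed
    then show "bounded X"
      by (auto simp: bounded_iff)
    show "\<Psi> ` X \<subseteq> K"
      using h by (auto simp: X_def \<Psi>_def \<Phi>_def intro!: K hb_mono)
    show "?S \<subseteq> \<Psi> ` X"
    proof
      fix x assume "x \<in> ?S"
      then obtain y s where x: "x = \<Phi> y s" and y: "y \<in> hyperplane_ball k (r / 2)" and s: "0 \<le> s" "s \<le> h / 4"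
        by (auto simp: \<Phi>_def)
      have "y $ k = 0"
        using y by (simp add: hyperplane_ball_def coord_hyperplane_def)
      then have "P (y + axis k (sqrt s)) = y" "(y + axis k (sqrt s)) $ k = sqrt s"
        by (simp_all add: P_def)
      then show "x \<in> \<Psi> ` X"
        using s y by (intro image_eqI[of _ _ "y + axis k (sqrt s)"]) (simp_all add: \<Psi>_def X_def x)
    qed
    show "0 < C" "0 < r / 4"
      using C r by simp_all
    fix N :: nat and p M and x x' :: "real ^ 'n"
    assume N: "0 < N" and p: "p \<in> poly_space N" and M: "\<And>y. y \<in> K \<Longrightarrow> \<bar>p y\<bar> \<le> M"
      and x: "x \<in> X" and x': "x' \<in> X" and close: "norm (x - x') \<le> r / 4"
    define y where "y = P x"
    define y' where "y' = P x'"
    define s where "s = (x $ k)\<^sup>2"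
    define s' where "s' = (x' $ k)\<^sup>2"
    define \<tau> where "\<tau> = norm (x - x')"
    have y: "y \<in> hyperplane_ball k (r / 2)" "y' \<in> hyperplane_ball k (r / 2)"
      using x x' by (simp_all add: X_def y_def y'_def)
    have s: "0 \<le> s" "s \<le> h / 4" "0 \<le> s'" "s' \<le> h / 4"
      using x x' by (simp_all add: X_def s_def s'_def)
    have yy: "norm (y' - y) \<le> \<tau>"
      using norm_P[of "x' - x"] by (simp add: y_def y'_def P_diff \<tau>_def norm_minus_commute)
    have ss: "\<bar>sqrt s - sqrt s'\<bar> \<le> \<tau>"
      using x x' component_le_norm_cart[of "x - x'" k] by (simp add: X_def s_def s'_def \<tau>_def)
    obtain g where g: "\<And>y'. y' \<in> hyperplane_ball k r \<Longrightarrow> \<bar>f y' - f y - g \<bullet> (y' - y)\<bar> \<le> L * (norm (y' - y))\<^sup>2"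
      using taylor[OF hb_mono[OF y(1)]] by blast
    have M\<Phi>: "\<bar>p (\<Phi> y s)\<bar> \<le> M" if "y \<in> hyperplane_ball k r" "0 \<le> s" "s \<le> h" for y s
      unfolding \<Phi>_def using that by (intro M K)
    have M0: "0 \<le> M"
      using M\<Phi>[OF hb_mono[OF y(1)], of 0] h by simp
    have NM: "0 \<le> real N * M"
      using M0 by simp
    have "norm (y' - y) \<le> r / 4"
      using yy close by (simp add: \<tau>_def)
    with bernstein_tangential[OF p N T r L g, where z = z and e = e and M = M and y' = y' and s = s]
      M\<Phi> y(1) hb_mono[OF y(2)] s(1,2)
    obtain \<sigma> where \<sigma>: "s \<le> \<sigma>" "\<sigma> \<le> h / 2" "\<sigma> \<le> s + 4 * L * (norm (y' - y))\<^sup>2"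
      and move: "\<bar>p (\<Phi> y s) - p (\<Phi> y' \<sigma>)\<bar> \<le> 12 / r * real N * M * norm (y' - y)"
      unfolding \<Phi>_def by blast
    have "4 * L * (norm (y' - y))\<^sup>2 \<le> 4 * L * \<tau>\<^sup>2"
      using yy L by (intro mult_left_mono power_mono) auto
    then have "\<sigma> \<le> s + (2 * sqrt L * \<tau>)\<^sup>2"
      using \<sigma>(3) L by (simp add: power_mult_distrib)
    also have "\<dots> \<le> (sqrt s + 2 * sqrt L * \<tau>)\<^sup>2"
      using s(1) L by (simp add: power2_sum \<tau>_def)
    finally have "sqrt \<sigma> \<le> sqrt s + 2 * sqrt L * \<tau>"
      using s(1) L by (intro real_le_lsqrt) (auto simp: \<tau>_def)
    moreover have "sqrt s \<le> sqrt \<sigma>"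
      using \<sigma>(1) by simp
    ultimately have "\<bar>sqrt \<sigma> - sqrt s'\<bar> \<le> (2 * sqrt L + 1) * \<tau>"
      using ss unfolding distrib_right by linarith
    then have "V * real N * M * \<bar>sqrt \<sigma> - sqrt s'\<bar> \<le> V * real N * M * ((2 * sqrt L + 1) * \<tau>)"
      using V NM by (intro mult_left_mono) (simp_all add: mult.assoc)
    moreover have "\<bar>p (\<Phi> y' \<sigma>) - p (\<Phi> y' s')\<bar> \<le> V * real N * M * \<bar>sqrt \<sigma> - sqrt s'\<bar>"
    proof -
      have \<Phi>: "\<Phi> y' s = (z + T y' + f y' *\<^sub>R e) + s *\<^sub>R e" for s
        by (simp add: \<Phi>_def scaleR_add_left add.assoc)
      show ?thesis
        unfolding V_def \<Phi>
        using s \<sigma> M\<Phi>[OF hb_mono[OF y(2)], unfolded \<Phi>] by (intro bernstein_segment_end[OF p N h]) auto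
    qed
    moreover have "12 / r * real N * M * norm (y' - y) \<le> 12 / r * real N * M * \<tau>"
      using yy r NM by (intro mult_left_mono) (simp_all add: mult.assoc)
    ultimately have "\<bar>p (\<Phi> y s) - p (\<Phi> y' s')\<bar> \<le>
        12 / r * real N * M * \<tau> + V * real N * M * ((2 * sqrt L + 1) * \<tau>)"
      using move by linarith
    also have "\<dots> = C * real N * M * \<tau>"
      by (simp add: C_def algebra_simps)
    finally show "\<bar>p (\<Psi> x) - p (\<Psi> x')\<bar> \<le> C * real N * M * norm (x - x')"
      by (simp add: \<Psi>_def \<tau>_def s_def s'_def y_def y'_def)
  qed
qed

section \<open>Taylor estimates for C11 functions on the hyperplane\<close>

text \<open>
  Composing \<open>f\<close> with the projection \<open>P\<close> onto the hyperplane gives a function on the whole space, where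
  derivatives are unique and are represented by vectors; as the composition is constant along the
  \<open>k\<close>-th axis, the representing vector lies in the hyperplane.
\<close>

lemma hyperplane_grad_has_derivative:
  fixes f :: "real ^ 'n \<Rightarrow> real"
  assumes y: "y \<in> coord_hyperplane k" and f: "f differentiable (at y within coord_hyperplane k)"
  shows "(f has_derivative (\<lambda>h. hyperplane_grad k f y \<bullet> h)) (at y within coord_hyperplane k)"
proof -
  let ?H = "coord_hyperplane k"
  define P where "P x = x - axis k (x $ k)" for x :: "real ^ 'n"
  have linP: "linear P"
    by (rule linearI) (simp_all add: P_def vec_eq_iff axis_def algebra_simps)
  have PH: "P x \<in> ?H" and P_id: "x \<in> ?H \<Longrightarrow> P x = x" for x
    by (auto simp: P_def coord_hyperplane_def axis_def vec_eq_iff)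
  have extend: "((\<lambda>x. f (P x)) has_derivative (\<lambda>h. D (P h))) (at y)"
    if "(f has_derivative D) (at y within ?H)" for D
  proof -
    have "(P has_derivative P) (at y)"
      using linP by (simp add: linear_imp_has_derivative)
    moreover have "(f has_derivative D) (at (P y) within range P)"
      using that PH unfolding P_id[OF y] by (rule_tac has_derivative_subset) auto
    ultimately show ?thesis
      using diff_chain_within[of P P y UNIV f D] by (simp add: o_def)
  qed
  have inner_P: "v \<bullet> P h = v \<bullet> h" if "v \<in> ?H" for v h
    using that by (simp add: P_def inner_diff_right inner_axis coord_hyperplane_def)
  obtain D where D: "(f has_derivative D) (at y within ?H)"
    using f by (auto simp: differentiable_def)
  have linD: "linear (\<lambda>h. D (P h))"
    using linear_compose[OF linP has_derivative_linear[OF D]] by (simp add: o_def)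
  define v where "v = (\<chi> i. D (P (axis i 1)))"
  have v_inner: "v \<bullet> h = D (P h)" for h
  proof -
    have "D (P h) = D (P (\<Sum>i\<in>UNIV. (h $ i) *\<^sub>R axis i 1))"
      using basis_expansion[of h] by (simp add: scalar_mult_eq_scaleR)
    also have "\<dots> = (\<Sum>i\<in>UNIV. h $ i * D (P (axis i 1)))"
      by (simp add: linear_sum[OF linD] linear_cmul[OF linD])
    finally show ?thesis
      by (simp add: inner_vec_def v_def mult.commute)
  qed
  have "P (axis k 1) = 0"
    by (simp add: P_def)
  then have vH: "v \<in> ?H"
    using has_derivative_linear[OF D] by (simp add: v_def coord_hyperplane_def linear_0)
  have "((\<lambda>x. f (P x)) has_derivative (\<lambda>h. v \<bullet> h)) (at y within ?H)"
    using extend[OF D] by (simp add: v_inner has_derivative_at_withinI)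
  then have v: "(f has_derivative (\<lambda>h. v \<bullet> h)) (at y within ?H)"
    by (rule has_derivative_transform[OF y, rotated]) (simp add: P_id)
  have "u = v" if u: "u \<in> ?H" "(f has_derivative (\<lambda>h. u \<bullet> h)) (at y within ?H)" for u
  proof -
    have "(\<lambda>h. u \<bullet> h) = (\<lambda>h. v \<bullet> h)"
      using has_derivative_unique[OF extend[OF u(2)] extend[OF v]] u(1) vH by (simp add: inner_P)
    then show ?thesis
      by (metis vector_eq_rdot)
  qed
  then have "hyperplane_grad k f y = v"
    unfolding hyperplane_grad_def using v vH by (intro the_equality) blast+
  then show ?thesis
    using v by simp
qed

lemma C11_taylor:
  fixes f :: "real ^ 'n \<Rightarrow> real"
  assumes "C11_on_ball k r f"
  obtains L where "0 \<le> L" and "\<And>y y'. y \<in> hyperplane_ball k r \<Longrightarrow> y' \<in> hyperplane_ball k r \<Longrightarrow>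
    \<bar>f y' - f y - hyperplane_grad k f y \<bullet> (y' - y)\<bar> \<le> L * (norm (y' - y))\<^sup>2"
proof -
  let ?H = "coord_hyperplane k" and ?B = "hyperplane_ball k r" and ?g = "hyperplane_grad k f"
  obtain L where lip: "L-lipschitz_on ?B ?g" and diff: "\<And>y. y \<in> ?B \<Longrightarrow> f differentiable (at y within ?H)"
    using assms unfolding C11_on_ball_def by blast
  have L: "0 \<le> L"
    using lip by (rule lipschitz_on_nonneg)
  have BH: "?B \<subseteq> ?H"
    by (auto simp: hyperplane_ball_def)
  have "\<bar>f y' - f y - ?g y \<bullet> (y' - y)\<bar> \<le> L * (norm (y' - y))\<^sup>2" if y: "y \<in> ?B" and y': "y' \<in> ?B" for y y'
  proof -
    define u where "u = y' - y"
    have "convex ?B"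
      unfolding hyperplane_ball_def coord_hyperplane_def
      by (intro convex_Int convex_ball) (simp add: convex_def)
    then have seg: "y + t *\<^sub>R u \<in> ?B" if "t \<in> {0..1}" for t
      using convexD_alt[of ?B y y' t] y y' that by (simp add: u_def algebra_simps)
    have deriv: "((\<lambda>t. f (y + t *\<^sub>R u)) has_derivative (\<lambda>d. ?g (y + t *\<^sub>R u) \<bullet> (d *\<^sub>R u))) (at t within {0..1})"
      if t: "t \<in> {0..1}" for t
    proof -
      have "((\<lambda>t. y + t *\<^sub>R u) has_derivative (\<lambda>d. d *\<^sub>R u)) (at t within {0..1})"
        by (auto intro!: derivative_eq_intros)
      moreover have "(f has_derivative (\<lambda>h. ?g (y + t *\<^sub>R u) \<bullet> h)) (at (y + t *\<^sub>R u) within (\<lambda>t. y + t *\<^sub>R u) ` {0..1})"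
      proof (rule has_derivative_subset)
        show "(f has_derivative (\<lambda>h. ?g (y + t *\<^sub>R u) \<bullet> h)) (at (y + t *\<^sub>R u) within ?H)"
          using seg[OF t] BH by (intro hyperplane_grad_has_derivative diff) auto
      qed (use seg BH in blast)
      ultimately show ?thesis
        using diff_chain_within[of "\<lambda>t. y + t *\<^sub>R u" "\<lambda>d. d *\<^sub>R u" t "{0..1}" f "\<lambda>h. ?g (y + t *\<^sub>R u) \<bullet> h"] by (simp add: o_def)
    qed
    obtain t where t: "t \<in> {0..1}" and mvt: "f (y + 1 *\<^sub>R u) - f (y + 0 *\<^sub>R u) = ?g (y + t *\<^sub>R u) \<bullet> ((1 - 0) *\<^sub>R u)"
      using mvt_very_simple[of 0 1 "\<lambda>t. f (y + t *\<^sub>R u)" "\<lambda>t d. ?g (y + t *\<^sub>R u) \<bullet> (d *\<^sub>R u)"] deriv by auto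
    have "\<bar>f y' - f y - ?g y \<bullet> u\<bar> = \<bar>(?g (y + t *\<^sub>R u) - ?g y) \<bullet> u\<bar>"
      using mvt by (simp add: u_def inner_diff_left)
    also have "\<dots> \<le> norm (?g (y + t *\<^sub>R u) - ?g y) * norm u"
      by (rule Cauchy_Schwarz_ineq2)
    also have "\<dots> \<le> (L * norm (t *\<^sub>R u)) * norm u"
      using lipschitz_onD[OF lip seg[OF t] y] by (intro mult_right_mono) (auto simp: dist_norm)
    also have "\<dots> \<le> (L * norm u) * norm u"
      using L t by (intro mult_right_mono mult_left_mono) (auto simp: mult_left_le_one_le)
    finally show ?thesis
      by (simp add: u_def power2_eq_square mult.assoc)
  qed
  with L show thesis
    by (rule that)
qed

lemma C11_continuous_on:
  assumes "C11_on_ball k r f" shows "continuous_on (hyperplane_ball k r) f"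
proof -
  have "continuous (at y within hyperplane_ball k r) f" if "y \<in> hyperplane_ball k r" for y
    using assms that unfolding C11_on_ball_def
    by (intro continuous_within_subset[OF differentiable_imp_continuous_within])
      (auto simp: hyperplane_ball_def)
  then show ?thesis
    by (simp add: continuous_on_eq_continuous_within)
qed

section \<open>Meshing near a boundary point\<close>

lemma graph_chart_iff:
  fixes \<phi> :: "real ^ 'n \<Rightarrow> real ^ 'n"
  assumes inj: "inj \<phi>" and f: "f ` hyperplane_ball k r \<subseteq> {-r<..<r}"
    and eq: "\<phi> ` graph_over k r f = F \<inter> \<phi> ` cylinder k r"
    and y: "y \<in> hyperplane_ball k r" and s: "\<bar>s\<bar> < r"
  shows "\<phi> (y + axis k s) \<in> F \<longleftrightarrow> s = f y"
proof
  assume "\<phi> (y + axis k s) \<in> F"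
  moreover have "y + axis k s \<in> cylinder k r"
    unfolding cylinder_def using y s by (intro image_eqI[of _ _ "(y, s)"]) auto
  ultimately have "\<phi> (y + axis k s) \<in> \<phi> ` graph_over k r f"
    unfolding eq by blast
  then have "y + axis k s \<in> graph_over k r f"
    using inj by (simp add: inj_image_mem_iff)
  then obtain y' where y': "y' \<in> hyperplane_ball k r" and e: "y + axis k s = y' + axis k (f y')"
    by (auto simp: graph_over_def)
  have "y $ k = 0" "y' $ k = 0"
    using y y' by (auto simp: hyperplane_ball_def coord_hyperplane_def)
  then have "s = f y'"
    using arg_cong[OF e, of "\<lambda>x. x $ k"] by simp
  then show "s = f y"
    using e by simp
next
  assume "s = f y"
  then have "\<phi> (y + axis k s) \<in> \<phi> ` graph_over k r f"
    using y by (auto simp: graph_over_def)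
  then show "\<phi> (y + axis k s) \<in> F"
    unfolding eq by blast
qed

text \<open>
  The open region strictly between the graph and its translate by \<open>\<sigma> * h\<close> is connected and avoids the
  frontier, hence lies in \<open>\<Omega>\<close> as soon as it meets the closure of \<open>\<Omega>\<close>. The values \<open>1\<close> and \<open>- 1\<close> of \<open>\<sigma>\<close>
  give the two sides of the graph.
\<close>

lemma one_side_of_graph:
  fixes \<phi> :: "real ^ 'n \<Rightarrow> real ^ 'n" and \<sigma> :: real
  assumes \<phi>: "continuous_on UNIV \<phi>" and f: "continuous_on (hyperplane_ball k r) f"
    and F: "\<And>y s. y \<in> hyperplane_ball k r \<Longrightarrow> 0 < s \<Longrightarrow> s < h \<Longrightarrow> \<phi> (y + axis k (f y + \<sigma> * s)) \<notin> frontier \<Omega>"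
    and y: "y \<in> hyperplane_ball k r" "0 < s" "s < h" and mem: "\<phi> (y + axis k (f y + \<sigma> * s)) \<in> closure \<Omega>"
    and y': "y' \<in> hyperplane_ball k r" "0 < s'" "s' < h"
  shows "\<phi> (y' + axis k (f y' + \<sigma> * s')) \<in> \<Omega>"
proof (rule ccontr)
  let ?B = "hyperplane_ball k r \<times> {0<..<h}"
  define g where "g = (\<lambda>(y, s). \<phi> (y + axis k (f y + \<sigma> * s)))"
  have axis: "axis k t = t *\<^sub>R (axis k 1 :: real ^ 'n)" for t
    by (simp add: vec_eq_iff axis_def)
  assume "\<phi> (y' + axis k (f y' + \<sigma> * s')) \<notin> \<Omega>"
  then have out: "g ` ?B - \<Omega> \<noteq> {}"
    using y' by (force simp: g_def)
  have "\<phi> (y + axis k (f y + \<sigma> * s)) \<in> \<Omega>"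
    using mem F[OF y] interior_subset by (auto simp: frontier_def)
  then have "g ` ?B \<inter> \<Omega> \<noteq> {}"
    using y by (force simp: g_def)
  moreover have "connected (g ` ?B)"
  proof (rule connected_continuous_image)
    have fst: "continuous_on ?B (\<lambda>x. f (fst x))"
      by (rule continuous_on_compose2[OF f continuous_on_fst[OF continuous_on_id]]) auto
    have "continuous_on ?B (\<lambda>x. \<phi> (fst x + (f (fst x) + \<sigma> * snd x) *\<^sub>R axis k 1))"
      by (rule continuous_on_compose2[OF \<phi>]) (intro continuous_intros fst, rule subset_UNIV)
    then show "continuous_on ?B g"
      by (simp only: g_def case_prod_beta' axis[symmetric])
    have "convex (hyperplane_ball k r)"
      unfolding hyperplane_ball_def coord_hyperplane_def
      by (intro convex_Int convex_ball) (simp add: convex_def)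
    then show "connected ?B"
      by (intro connected_Times convex_connected) auto
  qed
  ultimately have "g ` ?B \<inter> frontier \<Omega> \<noteq> {}"
    using out by (intro connected_Int_frontier)
  then show False
    using F by (auto simp: g_def)
qed

text \<open>
  Each side of the graph that meets \<open>\<Omega>\<close> is contained in \<open>\<Omega>\<close> and is meshed from the graph inwards. The
  definition of a \<open>C11\<close> domain leaves open whether \<open>\<Omega>\<close> lies on one side of its frontier or on both, so
  the neighbourhood is covered by the set \<open>\<Sigma>\<close> of those sides that have a mesh. Points of the graph belong to
  both sides, and \<open>\<Sigma>\<close> is nonempty because \<open>z\<close> is a limit of points of \<open>\<Omega>\<close>.
\<close>

lemma meshable_near_C11_boundary_point:
  fixes T :: "real ^ 'n \<Rightarrow> real ^ 'n" and z :: "real ^ 'n"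
  defines "\<phi> \<equiv> \<lambda>w. z + T w"
  assumes \<Omega>: "open \<Omega>" and T: "linear T" "bij T" and z: "z \<in> frontier \<Omega>" and r: "0 < r"
    and C11: "C11_on_ball k r f" and range: "f ` hyperplane_ball k r \<subseteq> {-r<..<r}" and f0: "f 0 = 0"
    and eq: "\<phi> ` graph_over k r f = frontier \<Omega> \<inter> \<phi> ` cylinder k r"
  shows "\<exists>U. open U \<and> z \<in> U \<and> meshable_in (closure \<Omega>) (closure \<Omega> \<inter> U)"
proof -
  let ?K = "closure \<Omega>"
  obtain L where L: "0 \<le> L" and taylor: "\<And>y y'. y \<in> hyperplane_ball k r \<Longrightarrow> y' \<in> hyperplane_ball k r \<Longrightarrow>
    \<bar>f y' - f y - hyperplane_grad k f y \<bullet> (y' - y)\<bar> \<le> L * (norm (y' - y))\<^sup>2"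
    using C11_taylor[OF C11] by blast
  have contf: "continuous_on (hyperplane_ball k r) f"
    using C11 by (rule C11_continuous_on)
  have zero: "0 \<in> hyperplane_ball k r"
    using r by (simp add: hyperplane_ball_def coord_hyperplane_def)
  have linP: "linear (\<lambda>x :: real ^ 'n. x - axis k (x $ k))"
    by (rule linearI) (simp_all add: vec_eq_iff axis_def algebra_simps)
  obtain \<delta> where \<delta>: "0 < \<delta>" and small: "\<And>y. y \<in> hyperplane_ball k r \<Longrightarrow> norm y < \<delta> \<Longrightarrow> \<bar>f y\<bar> < r / 2"
    using contf zero r f0 unfolding continuous_on_iff
    by (metis dist_0_norm dist_commute dist_real_def diff_zero half_gt_zero)
  \<comment> \<open>The radius \<open>\<rho>\<close> keeps \<open>\<bar>f\<bar>\<close> below \<open>r / 2\<close>, which leaves room for heights up to \<open>r / 2\<close> in the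
    cylinder, and satisfies \<open>L * \<rho>\<^sup>2 \<le> h / 8\<close>, which keeps the ellipses below the height \<open>h\<close>.\<close>
  define h where "h = r / 4"
  define q where "q = sqrt (h / (8 * (L + 1)))"
  define \<rho> where "\<rho> = min (min r \<delta>) q"
  have h: "0 < h"
    using r by (simp add: h_def)
  have q: "0 < q"
    using h L by (simp add: q_def)
  have \<rho>: "0 < \<rho>" "\<rho> \<le> r" "\<rho> \<le> \<delta>" "\<rho> \<le> q"
    using r \<delta> q by (auto simp: \<rho>_def)
  have L\<rho>: "L * \<rho>\<^sup>2 \<le> h / 8"
  proof -
    have "L * \<rho>\<^sup>2 \<le> (L + 1) * q\<^sup>2"
      using L \<rho> by (intro mult_mono power_mono) auto
    also have "\<dots> = h / 8"
      using L h by (simp add: q_def field_simps)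
    finally show ?thesis .
  qed
  have hb: "y \<in> hyperplane_ball k r" "\<bar>f y\<bar> < r / 2" if "y \<in> hyperplane_ball k \<rho>" for y
    using that \<rho> small[of y] by (auto simp: hyperplane_ball_def)
  have inj\<phi>: "inj \<phi>"
    using bij_is_inj[OF T(2)] by (auto simp: \<phi>_def inj_def)
  have cont\<phi>: "continuous_on UNIV \<phi>"
    unfolding \<phi>_def using T(1) by (intro continuous_intros linear_continuous_on) (simp add: linear_conv_bounded_linear)
  have frontier_iff: "\<phi> (y + axis k (f y + t)) \<in> frontier \<Omega> \<longleftrightarrow> t = 0"
    if "y \<in> hyperplane_ball k \<rho>" "\<bar>t\<bar> < r / 2" for y t
    using graph_chart_iff[OF inj\<phi> range eq, of y "f y + t"] hb[OF that(1)] that(2) by auto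
  define side where "side \<sigma> = {\<phi> (y + axis k (f y + \<sigma> * s)) |y s. y \<in> hyperplane_ball k (\<rho> / 2) \<and> 0 \<le> s \<and> s \<le> h / 4}"
    for \<sigma> :: real
  have one_side: "meshable_in ?K (side \<sigma>)"
    if \<sigma>: "\<bar>\<sigma>\<bar> = 1" and y: "y \<in> hyperplane_ball k \<rho>" "0 < s" "s < r / 2"
      and mem: "\<phi> (y + axis k (f y + \<sigma> * s)) \<in> ?K" for \<sigma> y s
  proof -
    have notF: "\<phi> (y + axis k (f y + \<sigma> * s)) \<notin> frontier \<Omega>"
      if "y \<in> hyperplane_ball k \<rho>" "0 < s" "s < r / 2" for y s
      using that \<sigma> by (subst frontier_iff) (auto simp: abs_mult)
    have inK: "\<phi> (y' + axis k (f y' + \<sigma> * s')) \<in> ?K"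
      if y': "y' \<in> hyperplane_ball k \<rho>" and s': "0 \<le> s'" "s' \<le> h" for y' s'
    proof (cases "s' = 0")
      case True
      then have "\<phi> (y' + axis k (f y' + \<sigma> * s')) \<in> frontier \<Omega>"
        using y' r by (subst frontier_iff) auto
      then show ?thesis
        by (simp add: frontier_def)
    next
      case False
      have "continuous_on (hyperplane_ball k \<rho>) f"
        using contf hb(1) by (rule_tac continuous_on_subset) auto
      then have "\<phi> (y' + axis k (f y' + \<sigma> * s')) \<in> \<Omega>"
        using notF y mem y' s' False h
        by (intro one_side_of_graph[OF cont\<phi>, of k \<rho> f "r / 2" \<sigma> \<Omega> y s]) (auto simp: h_def)
      then show ?thesis
        using closure_subset by blast
    qed
    \<comment> \<open>Below the graph, reflecting both the axis and \<open>f\<close> turns the region into one above a graph.\<close>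
    define e where "e = \<sigma> *\<^sub>R T (axis k 1)"
    have chart: "z + T y + (\<sigma> * f y + s) *\<^sub>R e = \<phi> (y + axis k (f y + \<sigma> * s))" for y s
    proof -
      have "axis k (f y + \<sigma> * s) = (f y + \<sigma> * s) *\<^sub>R (axis k 1 :: real ^ 'n)"
        by (simp add: vec_eq_iff axis_def)
      moreover have "(\<sigma> * f y + s) * \<sigma> = f y + \<sigma> * s"
        using \<sigma> by (auto simp: abs_if split: if_splits)
      ultimately show ?thesis
        using T(1) by (simp add: \<phi>_def e_def linear_add linear_cmul)
    qed
    have taylor': "\<exists>g. \<forall>y'\<in>hyperplane_ball k \<rho>. \<bar>\<sigma> * f y' - \<sigma> * f y - g \<bullet> (y' - y)\<bar> \<le> L * (norm (y' - y))\<^sup>2"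
      if "y \<in> hyperplane_ball k \<rho>" for y
    proof (intro exI[of _ "\<sigma> *\<^sub>R hyperplane_grad k f y"] ballI)
      fix y' assume "y' \<in> hyperplane_ball k \<rho>"
      have "\<bar>\<sigma> * f y' - \<sigma> * f y - (\<sigma> *\<^sub>R hyperplane_grad k f y) \<bullet> (y' - y)\<bar>
          = \<bar>\<sigma>\<bar> * \<bar>f y' - f y - hyperplane_grad k f y \<bullet> (y' - y)\<bar>"
        by (simp add: abs_mult[symmetric] right_diff_distrib)
      also have "\<dots> \<le> L * (norm (y' - y))\<^sup>2"
        using taylor[OF hb(1) hb(1), OF that \<open>y' \<in> _\<close>] \<sigma> by simp
      finally show "\<bar>\<sigma> * f y' - \<sigma> * f y - (\<sigma> *\<^sub>R hyperplane_grad k f y) \<bullet> (y' - y)\<bar> \<le> L * (norm (y' - y))\<^sup>2" .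
    qed
    show ?thesis
      using meshable_in_above_graph[OF T(1) \<rho>(1) h L L\<rho> taylor', of z e ?K] inK
      unfolding chart side_def by blast
  qed
  define A where "A = {w :: real ^ 'n. norm (w - axis k (w $ k)) < \<rho> / 2}"
  define W where "W = A \<inter> (\<lambda>w. w $ k - f (w - axis k (w $ k))) -` {- (h / 4)<..<h / 4}"
  define U where "U = \<phi> ` W"
  have contP: "continuous_on S (\<lambda>x :: real ^ 'n. x - axis k (x $ k))" for S
    using linP by (intro linear_continuous_on) (simp add: linear_conv_bounded_linear)
  have "open A"
    unfolding A_def by (intro open_Collect_less continuous_intros contP)
  moreover have "w - axis k (w $ k) \<in> hyperplane_ball k r" if "w \<in> A" for w
    using that \<rho> by (auto simp: A_def hyperplane_ball_def coord_hyperplane_def)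
  ultimately have "open W"
    unfolding W_def by (intro continuous_open_preimage continuous_intros continuous_on_compose2[OF contf contP]) auto
  then have "open (T ` W)"
    using T by (simp add: open_bijective_linear_image_eq)
  then have openU: "open U"
    using open_translation[of "T ` W" z] by (simp add: U_def \<phi>_def image_image)
  have "0 \<in> W"
    using \<rho> h f0 by (simp add: W_def A_def axis_eq_0_iff[THEN iffD2])
  then have zU: "z \<in> U"
    using T(1) by (auto simp: U_def \<phi>_def linear_0 intro!: image_eqI[of _ _ 0])
  have U_cases: "\<exists>y t. x = \<phi> (y + axis k (f y + t)) \<and> y \<in> hyperplane_ball k (\<rho> / 2) \<and> \<bar>t\<bar> < h / 4" if x: "x \<in> U" for x
  proof -
    obtain w where w: "x = \<phi> w" "w \<in> W"
      using x by (auto simp: U_def)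
    let ?y = "w - axis k (w $ k)"
    have "x = \<phi> (?y + axis k (f ?y + (w $ k - f ?y)))"
      by (simp add: w(1))
    moreover have "?y \<in> hyperplane_ball k (\<rho> / 2)"
      using w(2) by (simp add: W_def A_def hyperplane_ball_def coord_hyperplane_def)
    moreover have "w $ k - f ?y \<in> {- (h / 4)<..<h / 4}"
      using w(2) by (simp add: W_def)
    then have "\<bar>w $ k - f ?y\<bar> < h / 4"
      unfolding greaterThanLessThan_iff by linarith
    ultimately show ?thesis
      by blast
  qed
  have half: "y \<in> hyperplane_ball k \<rho>" if "y \<in> hyperplane_ball k (\<rho> / 2)" for y
    using that \<rho> by (auto simp: hyperplane_ball_def)
  define \<Sigma> where "\<Sigma> = {\<sigma> \<in> {1, - 1}. meshable_in ?K (side \<sigma>)}"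
  have pos: "\<exists>\<sigma>\<in>\<Sigma>. x \<in> side \<sigma>"
    if x: "x = \<phi> (y + axis k (f y + t))" "x \<in> ?K" and y: "y \<in> hyperplane_ball k (\<rho> / 2)"
      and t: "\<bar>t\<bar> < h / 4" "t \<noteq> 0" for x y t
  proof -
    have t': "t = sgn t * \<bar>t\<bar>"
      by (simp add: sgn_mult_abs)
    have "meshable_in ?K (side (sgn t))"
      using x y t t' half r by (intro one_side[of "sgn t" y "\<bar>t\<bar>"]) (auto simp: h_def abs_sgn_eq)
    then have "sgn t \<in> \<Sigma>"
      using t(2) by (auto simp: \<Sigma>_def sgn_if)
    moreover have "x \<in> side (sgn t)"
      unfolding side_def x(1) using y t(1) by (subst t') (auto intro!: exI[of _ y] exI[of _ "\<bar>t\<bar>"])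
    ultimately show ?thesis
      by blast
  qed
  have "\<Sigma> \<noteq> {}"
  proof -
    have "U \<inter> \<Omega> \<noteq> {}"
      using z zU open_Int_closure_eq_empty[OF openU, of \<Omega>] by (auto simp: frontier_def)
    then obtain x where x: "x \<in> U" "x \<in> \<Omega>"
      by blast
    then obtain y t where y: "x = \<phi> (y + axis k (f y + t))" "y \<in> hyperplane_ball k (\<rho> / 2)" "\<bar>t\<bar> < h / 4"
      using U_cases by blast
    have "x \<notin> frontier \<Omega>"
      using x \<Omega> by (simp add: frontier_def interior_open)
    then have "t \<noteq> 0"
      using frontier_iff[OF half[OF y(2)], of t] y r by (auto simp: h_def)
    moreover have "x \<in> ?K"
      using x closure_subset by blast
    ultimately show ?thesis
      using pos[OF y(1) _ y(2,3)] by blast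
  qed
  have "?K \<inter> U \<subseteq> \<Union>(side ` \<Sigma>)"
  proof
    fix x assume x: "x \<in> ?K \<inter> U"
    then obtain y t where y: "x = \<phi> (y + axis k (f y + t))" "y \<in> hyperplane_ball k (\<rho> / 2)" "\<bar>t\<bar> < h / 4"
      using U_cases by blast
    show "x \<in> \<Union>(side ` \<Sigma>)"
    proof (cases "t = 0")
      case True
      then have "x \<in> side \<sigma>" for \<sigma>
        unfolding side_def using y h by (auto intro!: exI[of _ y] exI[of _ "0::real"])
      then show ?thesis
        using \<open>\<Sigma> \<noteq> {}\<close> by blast
    next
      case False
      then show ?thesis
        using pos[OF y(1) _ y(2,3)] x by blast
    qed
  qed
  moreover have "meshable_in ?K (\<Union>(side ` \<Sigma>))"
    by (rule meshable_in_Union) (auto simp: \<Sigma>_def)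
  ultimately have "meshable_in ?K (?K \<inter> U)"
    by (rule meshable_in_mono[rotated])
  then show ?thesis
    using openU zU by blast
qed

section \<open>Existence of optimal meshes\<close>

theorem theorem3p3:
  fixes \<Omega> :: "(real ^ 'n) set" and k :: 'n
  assumes "bounded \<Omega>" and "C11_domain k \<Omega>"
  shows "\<exists>A. optimal_admissible_mesh (closure \<Omega>) A"
proof -
  have \<Omega>: "open \<Omega>" "\<Omega> \<noteq> {}"
    using assms(2) by (simp_all add: C11_domain_def)
  obtain r L where r: "0 < r" and chart: "\<forall>x\<in>frontier \<Omega>. \<exists>R f.
        rotation_matrix R \<and>
        C11_on_ball k r f \<and> f ` hyperplane_ball k r \<subseteq> {-r<..<r} \<and>
        f 0 = 0 \<and> hyperplane_grad k f 0 = 0 \<and> C11_norm k r f \<le> ennreal L \<and>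
        (\<lambda>z. x + R *v z) ` graph_over k r f =
          frontier \<Omega> \<inter> (\<lambda>z. x + R *v z) ` cylinder k r"
    using assms(2) unfolding C11_domain_def by blast
  have cpt: "compact (closure \<Omega>)"
    using assms(1) by simp
  have "meshable_in (closure \<Omega>) (closure \<Omega>)"
  proof (rule meshable_in_if_locally[OF cpt])
    fix z assume z: "z \<in> closure \<Omega>"
    show "\<exists>U. open U \<and> z \<in> U \<and> meshable_in (closure \<Omega>) (closure \<Omega> \<inter> U)"
    proof (cases "z \<in> \<Omega>")
      case True
      then obtain \<epsilon> where \<epsilon>: "0 < \<epsilon>" "ball z \<epsilon> \<subseteq> \<Omega>"
        using \<Omega> open_contains_ball by blast
      have "ball z (2 * (\<epsilon> / 2)) \<subseteq> closure \<Omega>"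
        using \<epsilon> closure_subset by force
      then have "meshable_in (closure \<Omega>) (ball z (\<epsilon> / 2))"
        using \<epsilon> by (intro meshable_in_interior) simp
      then have "meshable_in (closure \<Omega>) (closure \<Omega> \<inter> ball z (\<epsilon> / 2))"
        by (rule meshable_in_mono) blast
      then show ?thesis
        using \<epsilon> by (intro exI[of _ "ball z (\<epsilon> / 2)"]) simp
    next
      case False
      then have zF: "z \<in> frontier \<Omega>"
        using z \<Omega> by (simp add: frontier_def interior_open)
      obtain R f where R: "rotation_matrix R" and f: "C11_on_ball k r f" "f ` hyperplane_ball k r \<subseteq> {-r<..<r}" "f 0 = 0"
        and eq: "(\<lambda>w. z + R *v w) ` graph_over k r f = frontier \<Omega> \<inter> (\<lambda>w. z + R *v w) ` cylinder k r"
        using bspec[OF chart zF] by (elim exE conjE)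
      have "orthogonal_transformation ((*v) R)"
        using R by (simp add: rotation_matrix_def orthogonal_transformation_matrix)
      then have "bij ((*v) R)"
        by (rule orthogonal_transformation_bij)
      then show ?thesis
        using zF r f eq \<Omega> by (intro meshable_near_C11_boundary_point[of \<Omega> "(*v) R" z r k f]) simp_all
    qed
  qed
  moreover have "polynomial_determining (closure \<Omega>)"
    unfolding polynomial_determining_def
  proof (intro allI ballI impI)
    fix n and p :: "real ^ 'n \<Rightarrow> real"
    assume p: "p \<in> poly_space n" "\<forall>x\<in>closure \<Omega>. p x = 0"
    obtain a where "a \<in> \<Omega>"
      using \<Omega> by blast
    then show "p = (\<lambda>x. 0)"
      using p closure_subset by (intro poly_space_zero_if_zero_on_open[OF p(1) \<Omega>(1)]) auto
  qed
  ultimately show ?thesis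
    using \<Omega> cpt by (intro optimal_admissible_mesh_if_meshable) simp_all
qed

end
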